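(* Let $n \ge 7$ be an integer. The following statements are equivalent: (a) there exists a 6-valent first-kind Frobenius circulant $TL_n(a,b,1)$ of order $n$ such that the kernel of the underlying Frobenius group is cyclic (i.e. isomorphic to $\mathbb{Z}_n$); (b) $n \equiv 1 \pmod 6$ and the congruence $x^2 - x + 1 \equiv 0 \pmod n$ has a solution. Moreover, if one of these conditions holds, then: (c) every prime factor of $n$ is congruent to $1$ modulo $6$; (d) each solution $a$ of $x^2 - x + 1 \equiv 0 \pmod n$ gives rise to a 6-valent first-kind Frobenius circulant $TL_n(a,b,1)$, and vice versa; in this case $b \equiv a-1 \pmod n$, and $TL_n(a,a-1,1)$ is a rotational, geometric, $\mathbb{Z}_n \rtimes H$-arc-transitive, first-kind $\mathbb{Z}_n \rtimes H$-Frobenius graph admitting $[a]$ and $-[a^2]$ as complete rotations, where $$H = \langle [a] \rangle = \{\pm[1], \pm[a], \pm[a^2]\} = \{\pm[1],\pm[a],\pm[a-1]\} \le \mathbb{Z}_n^*;$$ (e) there are exactly $2^{l-1}$ pairwise non-isomorphic 6-valent first-kind Frobenius circulants (with cyclic kernel) of order $n$, where $l$ is the number of distinct prime factors of $n$, and each of them is isomorphic to $TL_n(a,a-1,1)$ for some solution $a$ of $x^2-x+1\equiv 0 \pmod n$.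
   Context: $\mathbb{Z}_n$ is the integers modulo $n$, $[m]$ denotes the residue class of $m$ modulo $n$, and $\mathbb{Z}_n^*$ is the group of units, identified with $\mathrm{Aut}(\mathbb{Z}_n)$ acting by multiplication. For a group $K$ and an inverse-closed $S \subseteq K\setminus\{1\}$, the Cayley graph $\mathrm{Cay}(K,S)$ has vertex set $K$, with $x,y$ adjacent iff $xy^{-1}\in S$. For integers $1\le a,b,c\le n-1$ with $a,b,c,n-a,n-b,n-c$ pairwise distinct, $TL_n(a,b,c)=\mathrm{Cay}(\mathbb{Z}_n,\{\pm[a],\pm[b],\pm[c]\})$ (additive group). $TL_n(a,b,c)$ is geometric if $a'+b'+c'\equiv 0 \pmod n$ for some $a'\in\{a,n-a\}$, $b'\in\{b,n-b\}$, $c'\in\{c,n-c\}$. A complete rotation of $\mathrm{Cay}(K,S)$ is an automorphism of the group $K$ fixing $S$ setwise and inducing a cyclic permutation on $S$; the graph is rotational if it admits one. A graph is $G$-arc-transitive if $G$ is a group of automorphisms transitive on ordered pairs of adjacent vertices. A Frobenius group is a transitive permutation group that is not regular and in which only the identity fixes two points; a finite Frobenius group is $G=K\rtimes H$ with $K$ (the kernel) a regular normal subgroup and $H$ (a complement) a point stabiliser; identifying the point set with $K$, $H$ acts on $K$ by conjugation. A first-kind $G$-Frobenius graph is $\mathrm{Cay}(K,s^H)$ where $s\in K$, $\langle s^H\rangle=K$, and either $|H|$ is even or $s$ is an involution. Here $\mathbb{Z}_n\rtimes H$ for $H\le\mathbb{Z}_n^*$ acts on $\mathbb{Z}_n$ by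 $[x]^{([y],[m])}=[(x+y)m]$. A 6-valent first-kind Frobenius circulant with cyclic kernel is a 6-valent circulant $TL_n(a,b,1)$ which is a first-kind $\mathbb{Z}_n\rtimes H$-Frobenius graph for some $H\le \mathbb{Z}_n^*$ such that $\mathbb{Z}_n\rtimes H$ is a Frobenius group with kernel $\mathbb{Z}_n$.
   Formalization: In (d), b ≡ a-1 is proved up to sign, b ≡ ±(a-1), since TL_n(a,b,1)=TL_n(a,n-b,1) (e.g. TL_7(3,5,1)); "vice versa" means each such circulant TL_n(a,b,1) equals TL_n(x,x-1,1) for some solution x, as a itself need not be one (e.g. TL_7(2,3,1)). *)

theory Defs
  imports "HOL-Number_Theory.Number_Theory"
begin

text \<open>Z_n is represented by the residues {0..<n} (naturals); [x] is x mod n.\<close>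

definition negm :: "nat \<Rightarrow> nat \<Rightarrow> nat" where
  "negm n x = (n - x mod n) mod n"

definition tl_valid :: "nat \<Rightarrow> nat \<Rightarrow> nat \<Rightarrow> nat \<Rightarrow> bool" where
  "tl_valid n a b c \<longleftrightarrow> 1 \<le> a \<and> a \<le> n - 1 \<and> 1 \<le> b \<and> b \<le> n - 1 \<and> 1 \<le> c \<and> c \<le> n - 1 \<and>
     distinct [a, b, c, n - a, n - b, n - c]"

definition conn :: "nat \<Rightarrow> nat \<Rightarrow> nat \<Rightarrow> nat \<Rightarrow> nat set" where
  "conn n a b c = {a mod n, negm n a, b mod n, negm n b, c mod n, negm n c}"

definition cay :: "nat \<Rightarrow> nat set \<Rightarrow> (nat \<times> nat) set" where
  "cay n S = {(x, y). x < n \<and> y < n \<and> (x + n - y) mod n \<in> S}"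

definition geometric :: "nat \<Rightarrow> nat \<Rightarrow> nat \<Rightarrow> nat \<Rightarrow> bool" where
  "geometric n a b c \<longleftrightarrow>
     (\<exists>a' \<in> {a, n - a}. \<exists>b' \<in> {b, n - b}. \<exists>c' \<in> {c, n - c}. (a' + b' + c') mod n = 0)"

text \<open>H is a subgroup of Z_n^* (finite, so a nonempty submonoid suffices).\<close>
definition units_subgroup :: "nat \<Rightarrow> nat set \<Rightarrow> bool" where
  "units_subgroup n H \<longleftrightarrow> H \<subseteq> {m. m < n \<and> coprime m n} \<and> 1 mod n \<in> H \<and>
     (\<forall>x\<in>H. \<forall>y\<in>H. (x * y) mod n \<in> H)"

definition sdp :: "nat \<Rightarrow> nat set \<Rightarrow> (nat \<times> nat) set" where
  "sdp n H = {(y, m). y < n \<and> m \<in> H}"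

definition act :: "nat \<Rightarrow> nat \<times> nat \<Rightarrow> nat \<Rightarrow> nat" where
  "act n g x = ((x + fst g) * snd g) mod n"

definition is_ident :: "nat \<Rightarrow> nat \<times> nat \<Rightarrow> bool" where
  "is_ident n g \<longleftrightarrow> (\<forall>x<n. act n g x = x)"

definition frobenius :: "nat \<Rightarrow> nat set \<Rightarrow> bool" where
  "frobenius n H \<longleftrightarrow>
     (\<forall>x<n. \<forall>y<n. \<exists>g\<in>sdp n H. act n g x = y) \<and>
     (\<exists>g\<in>sdp n H. \<not> is_ident n g \<and> (\<exists>x<n. act n g x = x)) \<and>
     (\<forall>g\<in>sdp n H. (\<exists>x1<n. \<exists>x2<n. x1 \<noteq> x2 \<and> act n g x1 = x1 \<and> act n g x2 = x2)
        \<longrightarrow> is_ident n g)"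

text \<open>Z_n \<rtimes> H (H \<le> Z_n^*) is a Frobenius group whose kernel (identity together with the
  fixed-point-free elements) is the translation subgroup Z_n.\<close>
definition frob_group :: "nat \<Rightarrow> nat set \<Rightarrow> bool" where
  "frob_group n H \<longleftrightarrow> units_subgroup n H \<and> frobenius n H \<and>
     (\<forall>g\<in>sdp n H. (is_ident n g \<or> (\<forall>x<n. act n g x \<noteq> x)) \<longleftrightarrow>
        (\<exists>y<n. \<forall>x<n. act n g x = (x + y) mod n))"

definition gen :: "nat \<Rightarrow> nat set \<Rightarrow> nat set" where
  "gen n A = \<Inter>{K. K \<subseteq> {0..<n} \<and> 0 \<in> K \<and> A \<subseteq> K \<and>
       (\<forall>x\<in>K. \<forall>y\<in>K. (x + y) mod n \<in> K) \<and> (\<forall>x\<in>K. negm n x \<in> K)}"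

definition first_kind :: "nat \<Rightarrow> nat set \<Rightarrow> nat set \<Rightarrow> bool" where
  "first_kind n H S \<longleftrightarrow> (\<exists>s<n. S = (\<lambda>m. (s * m) mod n) ` H \<and> gen n S = {0..<n} \<and>
     (even (card H) \<or> (s \<noteq> 0 \<and> (2 * s) mod n = 0)))"

definition frob_circ :: "nat \<Rightarrow> nat \<Rightarrow> nat \<Rightarrow> nat set \<Rightarrow> bool" where
  "frob_circ n a b H \<longleftrightarrow> tl_valid n a b 1 \<and> frob_group n H \<and> first_kind n H (conn n a b 1)"

definition complete_rotation :: "nat \<Rightarrow> nat set \<Rightarrow> nat \<Rightarrow> bool" where
  "complete_rotation n S m \<longleftrightarrow> m < n \<and> coprime m n \<and> (\<lambda>x. (m * x) mod n) ` S = S \<and>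
     (\<forall>x\<in>S. \<forall>y\<in>S. \<exists>k::nat. (m ^ k * x) mod n = y)"

definition rotational :: "nat \<Rightarrow> nat set \<Rightarrow> bool" where
  "rotational n S \<longleftrightarrow> (\<exists>m. complete_rotation n S m)"

definition arc_transitive :: "nat \<Rightarrow> nat set \<Rightarrow> (nat \<times> nat) set \<Rightarrow> bool" where
  "arc_transitive n H E \<longleftrightarrow>
     (\<forall>g\<in>sdp n H. bij_betw (act n g) {0..<n} {0..<n} \<and>
        (\<forall>x<n. \<forall>y<n. (x, y) \<in> E \<longleftrightarrow> (act n g x, act n g y) \<in> E)) \<and>
     (\<forall>p\<in>E. \<forall>q\<in>E. \<exists>g\<in>sdp n H. act n g (fst p) = fst q \<and> act n g (snd p) = snd q)"

definition cyc :: "nat \<Rightarrow> nat \<Rightarrow> nat set" where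
  "cyc n a = {(a ^ k) mod n | k. True}"

definition graph_iso :: "nat \<Rightarrow> (nat \<times> nat) set \<Rightarrow> (nat \<times> nat) set \<Rightarrow> bool" where
  "graph_iso n E1 E2 \<longleftrightarrow> (\<exists>f. bij_betw f {0..<n} {0..<n} \<and>
     (\<forall>x<n. \<forall>y<n. (x, y) \<in> E1 \<longleftrightarrow> (f x, f y) \<in> E2))"

definition frob_circs :: "nat \<Rightarrow> (nat \<times> nat) set set" where
  "frob_circs n = {cay n (conn n a b 1) | a b. \<exists>H. frob_circ n a b H}"

end

theory Submission
  imports Defs
begin

text \<open>If \<open>TL\<^sub>n(a,b,1)\<close> is a first-kind Frobenius graph, then \<open>H\<close> is the connection set itself, a group of six
  units in which \<open>h - 1\<close> is a unit for every \<open>h \<noteq> 1\<close>. This forces \<open>H\<close> to be generated by a root \<open>a\<close> of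
  \<open>x\<^sup>2 - x + 1\<close>, so that \<open>H = {\<plusminus>1, \<plusminus>a, \<plusminus>(a - 1)}\<close>. Elements \<open>u + v a\<close> are controlled by the Eisenstein norm
  \<open>u\<^sup>2 + u v + v\<^sup>2\<close>: if \<open>n\<close> divides \<open>u + v a\<close>, it divides the norm.

  For \<open>n > 7\<close> the neighbours of a vertex induce a 6-cycle, so an isomorphism preserves antipodal pairs of
  neighbours. It therefore maps the progression \<open>x - 1, x, x + 1\<close> to an arithmetic progression, hence is affine,
  and it carries \<open>H\<close> to a multiple of \<open>H'\<close>. So distinct graphs are non-isomorphic, and each graph comes from exactly the two
  roots \<open>a\<close> and \<open>1 - a\<close>. Relative to one root \<open>x\<close>, every root is congruent to \<open>x\<close> or \<open>1 - x\<close> modulo each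
  prime power factor of \<open>n\<close>, which gives \<open>2\<^sup>l\<close> roots by the Chinese remainder theorem.\<close>

section \<open>Roots of \<open>x\<^sup>2 - x + 1\<close> and their powers\<close>

text \<open>The statement represents Z_n by naturals, while the algebra needs subtraction;
  \<open>res\<close> carries integer congruences over to that representation.\<close>

definition res :: "nat \<Rightarrow> int \<Rightarrow> nat" where
  "res n u = nat (u mod int n)"

abbreviation hexroot :: "nat \<Rightarrow> int \<Rightarrow> bool" where
  "hexroot n a \<equiv> [a^2 - a + 1 = 0] (mod int n)"

text \<open>These are integer representatives of the sixth roots of unity generated by a root
  \<open>a\<close>. They are kept linear in \<open>a\<close>, so that the set is closed under
  negation exactly and differences of members can be tested by the Eisenstein norm.\<close>

definition hexagon :: "int \<Rightarrow> int set" where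
  "hexagon a = {1, -1, a, -a, a - 1, 1 - a}"

section \<open>Natural residues and integer congruences\<close>

lemma int_res: "n > 0 \<Longrightarrow> int (res n u) = u mod int n"
  by (simp add: res_def)

lemma res_less: "n > 0 \<Longrightarrow> res n u < n"
  by (simp add: res_def nat_less_iff)

lemma res_eq_iff: "n > 0 \<Longrightarrow> res n u = res n v \<longleftrightarrow> [u = v] (mod int n)"
  by (simp add: res_def cong_def nat_eq_iff)

lemma res_int: "res n (int x) = x mod n"
  by (simp add: res_def flip: zmod_int)

lemma res_of_nat: "x < n \<Longrightarrow> res n (int x) = x"
  by (simp add: res_int)

lemma eq_res_iff: "x < n \<Longrightarrow> x = res n u \<longleftrightarrow> [int x = u] (mod int n)"
  by (metis res_eq_iff res_of_nat gr_zeroI not_less_zero)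

lemma mod_eq_res: "(x::nat) mod n = res n (int x)"
  by (simp add: res_int)

lemma res_cong: "n > 0 \<Longrightarrow> [int (res n u) = u] (mod int n)"
  by (simp add: int_res cong_def)

lemma negm_eq_res:
  assumes "n > 0"
  shows "negm n x = res n (- int x)"
proof -
  have "int n - int x mod int n = int (n - x mod n)"
    using assms by (simp add: of_nat_diff zmod_int less_imp_le)
  then have "[int (n - x mod n) = - int x] (mod int n)"
    by (simp add: cong_def) (metis minus_mod_self1 mod_minus_eq minus_mod_eq_mult_div mod_diff_right_eq diff_0 mod_diff_left_eq mod_self)
  then show ?thesis
    using assms by (simp add: negm_def mod_eq_res res_eq_iff)
qed

lemma conn_eq_res:
  assumes "n > 0"
  shows "conn n a b c = res n ` {int a, - int a, int b, - int b, int c, - int c}"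
  using assms by (simp add: conn_def negm_eq_res mod_eq_res)

lemma conn_hexagon:
  assumes "n > 0" "a \<ge> 1"
  shows "conn n a (a - 1) 1 = res n ` hexagon (int a)"
  using assms by (simp add: conn_eq_res hexagon_def of_nat_diff) auto

text \<open>The conjugate root is 1 - a, so u + v a has conjugate u + v - v a; the product of the
  two is the norm up to a multiple of a^2 - a + 1.\<close>

lemma hexroot_norm:
  assumes "hexroot n a" "int n dvd u + v * a"
  shows "int n dvd u^2 + u*v + v^2"
proof -
  have "u^2 + u*v + v^2 = (u + v*a) * (u + v - v*a) + v^2 * (a^2 - a + 1)"
    by (simp add: algebra_simps power2_eq_square)
  then show ?thesis
    using assms by (simp add: cong_0_iff)
qed

text \<open>The norm is a positive definite form, so a nonzero norm below n is too small to be a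
  multiple of n.\<close>

lemma hexroot_nonzero:
  assumes "hexroot n a" "u^2 + u*v + v^2 \<noteq> 0" "u^2 + u*v + v^2 < int n"
  shows "\<not> int n dvd u + v * a"
proof
  assume "int n dvd u + v * a"
  then have "int n dvd u^2 + u*v + v^2"
    using hexroot_norm assms(1) by blast
  moreover have "u^2 + u*v + v^2 > 0"
  proof -
    define X where "X = u^2 + u*v + v^2"
    have "4 * X = (2*u + v)^2 + 3 * v^2"
      by (simp add: X_def algebra_simps power2_eq_square)
    moreover have "(2*u + v)^2 + 3 * v^2 \<ge> 0" by simp
    ultimately have "4 * X \<ge> 0" by simp
    then show ?thesis using assms(2) by (simp add: X_def[symmetric])
  qed
  ultimately show False
    using assms(3) zdvd_imp_le by fastforce
qed

lemma hexroot_coprime: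
  assumes "hexroot n a" "coprime (u^2 + u*v + v^2) (int n)"
  shows "coprime (u + v * a) (int n)"
proof (rule coprimeI)
  fix c assume c: "c dvd u + v*a" "c dvd int n"
  have "u^2 + u*v + v^2 = (u + v*a) * (u + v - v*a) + v^2 * (a^2 - a + 1)"
    by (simp add: algebra_simps power2_eq_square)
  moreover have "c dvd a^2 - a + 1"
    using assms(1) c(2) by (meson cong_0_iff dvd_trans)
  ultimately have "c dvd u^2 + u*v + v^2"
    using c(1) by simp
  then show "is_unit c"
    using assms(2) c(2) coprime_common_divisor by blast
qed

section \<open>Multiplication in the hexagon\<close>

lemma hexagon_mult:
  assumes "hexroot n a" "u \<in> hexagon a" "v \<in> hexagon a"
  shows "\<exists>w\<in>hexagon a. [u * v = w] (mod int n)"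
proof -
  have r: "[a*a = a - 1] (mod int n)"
    using assms(1) by (simp add: cong_iff_dvd_diff power2_eq_square algebra_simps)
  have k: "\<exists>w\<in>hexagon a. [a * u = w] (mod int n)" if u: "u \<in> hexagon a" for u
  proof -
    have "[a * (a - 1) = - 1] (mod int n)" "[a * (1 - a) = 1] (mod int n)"
         "[a * (- a) = 1 - a] (mod int n)" "[a * a = a - 1] (mod int n)" 
      using assms(1) by (auto simp add: cong_iff_dvd_diff power2_eq_square algebra_simps dvd_diff_commute)
    then show ?thesis
      using u unfolding hexagon_def by (elim insertE) auto
  qed
  have m: "- w \<in> hexagon a" if "w \<in> hexagon a" for w
    using that by (auto simp: hexagon_def)
  \<comment> \<open>Since a - 1 is congruent to a * a, multiplying by it amounts to multiplying by
    \<open>a\<close> twice. The other three values of \<open>u\<close> differ from these only by a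
    sign.\<close>
  have pos: "\<exists>w\<in>hexagon a. [u * v = w] (mod int n)" if u: "u \<in> {1, a, a - 1}" and "v \<in> hexagon a" for u v
  proof -
    consider "u = 1" | "u = a" | "u = a - 1" using u by blast
    then show ?thesis
    proof cases
      case 3
      obtain w where w: "w \<in> hexagon a" "[a * v = w] (mod int n)"
        using k \<open>v \<in> hexagon a\<close> by blast
      obtain w' where w': "w' \<in> hexagon a" "[a * w = w'] (mod int n)"
        using k w by blast
      have "[u * v = a * a * v] (mod int n)"
        using 3 r by (metis cong_scalar_right cong_sym)
      moreover have "[a * a * v = a * w] (mod int n)"
        using w by (metis cong_scalar_left mult.assoc)
      ultimately show ?thesis
        using w' cong_trans by blast
    qed (use \<open>v \<in> hexagon a\<close> k in \<open>auto intro: cong_refl\<close>)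
  qed
  show ?thesis
  proof (cases "u \<in> {1, a, a - 1}")
    case True
    then show ?thesis using pos assms by blast
  next
    case False
    then have "- u \<in> {1, a, a - 1}"
      using assms(2) by (auto simp: hexagon_def)
    then obtain w where "w \<in> hexagon a" "[- u * v = w] (mod int n)"
      using pos assms(3) by blast
    then show ?thesis
      using m by (metis cong_minus_minus_iff minus_minus minus_mult_left)
  qed
qed

lemma hexroot_cube:
  assumes "hexroot n a"
  shows "[a^3 = -1] (mod int n)"
proof -
  have "a^3 - (-1) = (a + 1) * (a^2 - a + 1)"
    by (simp add: algebra_simps power2_eq_square power3_eq_cube)
  then show ?thesis
    using assms by (simp add: cong_iff_dvd_diff)
qed

text \<open>The hexagon consists of the powers of \<open>a\<close>, since \<open>a\<^sup>2 = a - 1\<close> and \<open>a\<^sup>3 = - 1\<close> modulo \<open>n\<close>.\<close>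

lemma hexagon_power:
  assumes "hexroot n a" "u \<in> hexagon a"
  shows "\<exists>k. [a^k = u] (mod int n)"
proof -
  have r: "[a^2 = a - 1] (mod int n)"
    using assms(1) by (simp add: cong_iff_dvd_diff algebra_simps)
  have c: "[a^3 = -1] (mod int n)" using hexroot_cube assms(1) .
  have "[a^4 = - a] (mod int n)"
    using cong_scalar_left[OF c, of a] by (simp add: eval_nat_numeral)
  moreover have "[a^5 = -(a^2)] (mod int n)"
    using cong_scalar_left[OF c, of "a^2"] by (simp add: eval_nat_numeral mult.assoc)
  then have "[a^5 = 1 - a] (mod int n)"
    using r by (metis cong_minus_minus_iff cong_trans minus_diff_eq)
  moreover have "[a^0 = 1] (mod int n)" "[a^1 = a] (mod int n)" by auto
  ultimately show ?thesis
    using assms(2) r c unfolding hexagon_def by (elim insertE) blast+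
qed

lemma power_hexagon:
  assumes "hexroot n a" "u \<in> hexagon a"
  shows "\<exists>w\<in>hexagon a. [u^k = w] (mod int n)"
proof (induction k)
  case 0
  then show ?case by (auto simp: hexagon_def)
next
  case (Suc k)
  then obtain w where "w \<in> hexagon a" "[u^k = w] (mod int n)" by blast
  then show ?case
    using hexagon_mult[OF assms(1,2)] by (metis cong_scalar_left cong_trans power_Suc)
qed

lemma hexroot_conj:
  assumes "hexroot n a"
  shows "hexroot n (1 - a)"
proof -
  have "(1 - a)^2 - (1 - a) + 1 = a^2 - a + 1"
    by (simp add: algebra_simps power2_eq_square)
  then show ?thesis using assms by metis
qed

lemma hexagon_conj: "hexagon (1 - a) = hexagon a"
  by (auto simp: hexagon_def)

lemma hexagon_inverse:
  assumes "hexroot n a" "u \<in> hexagon a"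
  shows "\<exists>v\<in>hexagon a. [u * v = 1] (mod int n)"
proof -
  have c: "[a * (1 - a) = 1] (mod int n)"
    using assms(1) by (simp add: cong_iff_dvd_diff power2_eq_square algebra_simps dvd_diff_commute)
  consider "u = 1" | "u = -1" | "u = a" | "u = -a" | "u = a - 1" | "u = 1 - a"
    using assms(2) by (auto simp: hexagon_def)
  then show ?thesis
  proof cases
    case 3 then show ?thesis using c by (intro bexI[of _ "1 - a"]) (auto simp: hexagon_def)
  next
    case 4 then show ?thesis using c by (intro bexI[of _ "a - 1"]) (auto simp: hexagon_def algebra_simps)
  next
    case 5 then show ?thesis using c by (intro bexI[of _ "- a"]) (auto simp: hexagon_def algebra_simps)
  next
    case 6 then show ?thesis using c by (intro bexI[of _ "a"]) (auto simp only: hexagon_def mult.commute)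
  qed (auto simp: hexagon_def intro: bexI[of _ 1] bexI[of _ "-1"])
qed

text \<open>The five differences u - 1 have norms 1, 3 or 4, all coprime to n when n is coprime to
  6. This is the fixed-point condition of a Frobenius group.\<close>

lemma hexagon_coprime_diff:
  assumes "hexroot n a" "coprime n 6" "u \<in> hexagon a" "u \<noteq> 1"
  shows "coprime (u - 1) (int n)"
proof -
  have c: "coprime 2 (int n)" "coprime 3 (int n)"
    using assms(2) coprime_int_iff[of n 6] coprime_mult_right_iff[of "int n" 2 3]
    by (simp_all add: coprime_commute)
  then have c4: "coprime 4 (int n)"
    using coprime_mult_left_iff[of 2 2 "int n"] by simp
  have *: "coprime (x + y * a) (int n)" if "x^2 + x*y + y^2 \<in> {1,3,4}" for x y
    using that c c4 by (intro hexroot_coprime[OF assms(1)]) auto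
  have "- a - 1 = -1 + -1 * a" by simp
  then have "coprime (- a - 1) (int n)"
    using *[of "-1" "-1"] by (simp only:) simp
  then show ?thesis
    using assms(3,4) *[of "-2" 0] *[of "-1" 1] *[of "-2" 1] *[of 0 "-1"]
    by (auto simp: hexagon_def)
qed

text \<open>A root has cube -1. If p = 3k + 2, Fermat's theorem reduces to x = 1 or x = -1 modulo p,
  where the polynomial takes the values 1 and 3. The prime 2 is excluded because the polynomial is
  always odd.\<close>

lemma hexroot_prime:
  fixes p :: nat
  assumes "prime p" "p \<noteq> 3" "hexroot p x"
  shows "p mod 6 = 1"
proof -
  have d: "int p dvd x^2 - x + 1" using assms(3) by (simp add: cong_0_iff)
  have "odd (x^2 - x + 1)" by simp
  then have p2: "p \<noteq> 2" using d by (metis of_nat_numeral)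
  have "odd p" using assms(1) p2 prime_odd_nat prime_ge_2_nat by (metis le_neq_implies_less)
  have nd: "\<not> int p dvd x"
  proof
    assume "int p dvd x"
    then have "int p dvd x^2 - x" by (simp add: power2_eq_square)
    then have "int p dvd 1" using d by (metis dvd_add_right_iff)
    then show False using assms(1) by (simp add: prime_nat_iff)
  qed
  define y where "y = res p x"
  have p0: "p > 0" using assms(1) prime_gt_0_nat by blast
  have y: "[int y = x] (mod int p)" unfolding y_def by (rule res_cong[OF p0])
  have "\<not> p dvd y" using nd y by (metis cong_dvd_iff int_dvd_int_iff cong_sym)
  then have "[y^(p-1) = 1] (mod p)" using fermat_theorem assms(1) by blast
  then have "[int y^(p-1) = 1] (mod int p)"
    by (metis cong_int_iff of_nat_1 of_nat_power)
  then have f: "[x^(p-1) = 1] (mod int p)"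
    using y by (meson cong_pow cong_sym cong_trans)
  have m3: "p mod 3 \<noteq> 2"
  proof
    assume a: "p mod 3 = 2"
    define k where "k = p div 3"
    have "p = 3*k + 2" using a unfolding k_def by (metis mult_div_mod_eq)
    then have "x^(p-1) = (x^3)^k * x" by (simp add: power_mult)
    moreover have "[(x^3)^k * x = (-1)^k * x] (mod int p)"
      using hexroot_cube[OF assms(3)] by (intro cong_mult cong_pow) auto
    ultimately have "[(-1)^k * x = 1] (mod int p)"
      using f by (metis cong_sym cong_trans)
    then have "[x = 1] (mod int p) \<or> [x = -1] (mod int p)"
      by (cases "even k") (auto, metis cong_minus_minus_iff minus_minus)
    then have "\<exists>e\<in>{1,-1}. [e^2 - e + 1 = x^2 - x + 1] (mod int p)"
      by (metis insertCI cong_add cong_diff cong_pow cong_refl cong_sym)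
    then have "int p dvd 1 \<or> int p dvd 3"
      using assms(3) by (auto simp: cong_0_iff dest: cong_dvd_iff)
    then have "p dvd 1 \<or> p dvd 3" by (metis int_dvd_int_iff of_nat_1 of_nat_numeral)
    moreover have "prime (3::nat)" by simp
    ultimately show False
      using assms(1,2) by (metis not_prime_unit primes_dvd_imp_eq)
  qed
  have "p mod 3 \<noteq> 0" using assms(1,2) primes_dvd_imp_eq[of 3 p] by (auto simp: mod_eq_0_iff_dvd)
  then show ?thesis using m3 \<open>odd p\<close> by presburger
qed

lemma mod6_from_primes:
  fixes n :: nat
  assumes "n > 0" "\<And>p. prime p \<Longrightarrow> p dvd n \<Longrightarrow> p mod 6 = 1"
  shows "n mod 6 = 1"
  using assms
proof (induction n rule: less_induct)
  case (less n)
  show ?case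
  proof (cases "n = 1")
    case False
    then obtain p where p: "prime p" "p dvd n" using prime_factor_nat by blast
    then obtain m where m: "n = p * m" by blast
    have "m < n" "m > 0" using m p less.prems(1) prime_gt_1_nat by auto
    then have "m mod 6 = 1" using less m by (metis dvd_mult)
    moreover have "p mod 6 = 1" using less.prems p by blast
    ultimately show ?thesis using m by (metis mod_mult_eq mult_1 mod_less one_less_numeral_iff semiring_norm(76))
  qed simp
qed

section \<open>Frobenius groups and first-kind graphs\<close>

lemma coprime_of_cong_1:
  "[u * v = 1] (mod (m::int)) \<Longrightarrow> coprime u m"
  using coprime_iff_invertible_int by blast

lemma hexagon_coprime:
  assumes "hexroot n a" "u \<in> hexagon a"
  shows "coprime u (int n)"
  using hexagon_inverse[OF assms] coprime_of_cong_1 by blast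

lemma coprime_res:
  assumes "n > 0" "coprime u (int n)"
  shows "coprime (res n u) n"
proof -
  have "coprime (int (res n u)) (int n)"
    using assms by (metis cong_imp_coprime cong_sym res_cong)
  then show ?thesis by simp
qed

lemma res_minus_of_nat: "0 < x \<Longrightarrow> x \<le> n \<Longrightarrow> res n (- int x) = n - x"
  by (rule sym, subst eq_res_iff) (auto simp: of_nat_diff cong_iff_dvd_diff)

lemma res_mult_mod:
  assumes "n > 0"
  shows "(res n u * res n v) mod n = res n (u * v)"
proof -
  have "[int (res n u * res n v) = u * v] (mod int n)"
    using cong_mult[OF res_cong[OF assms, of u] res_cong[OF assms, of v]] by simp
  then show ?thesis
    using assms by (simp only: mod_eq_res res_eq_iff)
qed

lemma gen_eq_full:
  assumes "n > 1" "S \<subseteq> {0..<n}" "1 \<in> S"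
  shows "gen n S = {0..<n}"
proof
  show "gen n S \<subseteq> {0..<n}"
    using assms unfolding gen_def by (intro Inter_lower) (auto simp: negm_def)
  show "{0..<n} \<subseteq> gen n S"
  proof (unfold gen_def, intro Inter_greatest subsetI)
    fix K k
    assume "K \<in> {K. K \<subseteq> {0..<n} \<and> 0 \<in> K \<and> S \<subseteq> K \<and>
       (\<forall>x\<in>K. \<forall>y\<in>K. (x + y) mod n \<in> K) \<and> (\<forall>x\<in>K. negm n x \<in> K)}"
    then have K: "0 \<in> K" "1 \<in> K" "\<And>x y. x \<in> K \<Longrightarrow> y \<in> K \<Longrightarrow> (x + y) mod n \<in> K"
      using assms(3) by auto
    assume "k \<in> {0..<n}"
    then have "k < n" by simp
    then show "k \<in> K"
    proof (induction k)
      case (Suc k)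
      then show ?case using K(2) K(3)[of k 1] by simp
    qed (use K in simp)
  qed
qed

section \<open>Fixed points of affine maps and the Frobenius property\<close>

lemma act_eq_iff:
  assumes "z < n"
  shows "act n (y, m) x = z \<longleftrightarrow> [(int x + int y) * int m = int z] (mod int n)"
proof -
  have "act n (y, m) x = res n ((int x + int y) * int m)"
    by (simp add: act_def mod_eq_res)
  then show ?thesis
    using assms by (metis res_eq_iff res_of_nat gr_zeroI not_less_zero)
qed

lemma act_less: "n > 0 \<Longrightarrow> act n g x < n"
  by (simp add: act_def)

lemma act_cong:
  assumes "n > 0"
  shows "[int (act n (y, m) x) = (int x + int y) * int m] (mod int n)"
  using act_eq_iff[of "act n (y, m) x" n y m x] act_less assms cong_sym by blast

lemma affine_fixed_point:
  assumes "n > 0" "coprime (int m - 1) (int n)"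
  shows "\<exists>!x. x < n \<and> act n (y, m) x = x"
proof -
  obtain j where j: "[(int m - 1) * j = 1] (mod int n)"
    using assms(2) cong_solve_coprime_int by blast
  \<comment> \<open>A fixed point solves the linear congruence (m - 1) z = - y m, and
    \<open>j\<close> is the inverse of m - 1.\<close>
  define z where "z = - (int y * int m * j)"
  have "[(z + int y) * int m - z = int y * int m * (1 - (int m - 1) * j)] (mod int n)"
    unfolding z_def by (simp add: algebra_simps)
  moreover have "[int y * int m * (1 - (int m - 1) * j) = int y * int m * (1 - 1)] (mod int n)"
    using j by (intro cong_mult cong_diff cong_refl) 
  ultimately have "[(z + int y) * int m - z = 0] (mod int n)"
    using cong_trans by fastforce
  then have z: "[(z + int y) * int m = z] (mod int n)"
    using cong_diff_iff_cong_0 by blast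
  have r: "[int (res n z) = z] (mod int n)"
    using res_cong assms(1) by blast
  then have "[(int (res n z) + int y) * int m = (z + int y) * int m] (mod int n)"
    by (intro cong_mult cong_add cong_refl)
  then have "[(int (res n z) + int y) * int m = int (res n z)] (mod int n)"
    using z r by (meson cong_sym cong_trans)
  then have "act n (y, m) (res n z) = res n z"
    using act_eq_iff res_less assms(1) by blast
  moreover have "x = x'" if "x < n" "act n (y, m) x = x" "x' < n" "act n (y, m) x' = x'" for x x'
  proof -
    have "[(int x + int y) * int m - (int x' + int y) * int m = int x - int x'] (mod int n)"
      using that by (intro cong_diff) (simp_all add: act_eq_iff)
    then have "int n dvd (int x - int x') * (int m - 1)"
      by (simp add: cong_iff_dvd_diff algebra_simps)
    then have "int n dvd int x - int x'"
      using assms(2) coprime_commute coprime_dvd_mult_left_iff by blast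
    then show ?thesis
      using that by (metis cong_iff_dvd_diff cong_int_iff cong_less_modulus_unique_nat)
  qed
  ultimately show ?thesis
    using res_less assms(1) by metis
qed

text \<open>An element with multiplier m other than 1 has exactly one fixed point, and a nonzero
  translation has none. Both the Frobenius condition and the description of the kernel follow from
  this dichotomy.\<close>

lemma frob_groupI:
  assumes "n \<ge> 3" and H: "units_subgroup n H" and "n - 1 \<in> H"
    and cop: "\<And>m. m \<in> H \<Longrightarrow> m \<noteq> 1 \<Longrightarrow> coprime (int m - 1) (int n)"
  shows "frob_group n H"
proof -
  have n0: "n > 0" using assms by simp
  have one: "1 \<in> H" using H assms(1) by (simp add: units_subgroup_def)
  have mless: "m < n" if "m \<in> H" for m
    using H that by (auto simp: units_subgroup_def)
  have tr: "act n (y, 1) x = (x + y) mod n" for x y by (simp add: act_def)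
  have fix1: "y = 0" if "y < n" "x < n" "act n (y, 1) x = x" for x y
  proof -
    have "[x + y = x + 0] (mod n)" using that(2) that(3)[unfolded tr] by (simp add: cong_def)
    then have "[y = 0] (mod n)" using cong_add_lcancel_nat by blast
    then show ?thesis using that(1) by (simp add: cong_def)
  qed
  have id0: "is_ident n (0, 1)" by (simp add: is_ident_def act_def)
  have nid: "\<not> is_ident n (y, m)" if "m \<in> H" "m \<noteq> 1" for y m
  proof
    assume "is_ident n (y, m)"
    then have "act n (y, m) 0 = 0" "act n (y, m) 1 = 1"
      using assms(1) by (auto simp: is_ident_def)
    then show False
      using affine_fixed_point[OF n0 cop[OF that], of y] assms(1)
      by (metis n0 zero_neq_one less_le_trans numeral_3_eq_3 Suc_less_eq One_nat_def zero_less_Suc)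
  qed
  have "frobenius n H"
    unfolding frobenius_def
  proof (intro conjI allI impI ballI)
    fix x y assume xy: "x < n" "y < n"
    let ?z = "res n (int y - int x)"
    have "[int x + int ?z = int x + (int y - int x)] (mod int n)"
      using res_cong[OF n0] by (intro cong_add cong_refl)
    then have "act n (?z, 1) x = y"
      using xy by (subst act_eq_iff) auto
    then show "\<exists>g\<in>sdp n H. act n g x = y"
      using one res_less[OF n0] by (intro bexI[of _ "(?z, 1)"]) (auto simp: sdp_def)
  next
    \<comment> \<open>Multiplication by -1 fixes 0 without being the identity, so the group is not
      regular.\<close>
    have "n - 1 \<noteq> 1" using assms(1) by simp
    then have "\<not> is_ident n (0, n - 1)" using nid assms(3) by blast
    moreover have "(0, n - 1) \<in> sdp n H" "act n (0, n - 1) 0 = 0"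
      using assms(3) n0 by (auto simp: sdp_def act_def)
    ultimately show "\<exists>g\<in>sdp n H. \<not> is_ident n g \<and> (\<exists>x<n. act n g x = x)"
      using n0 by blast
  next
    fix g assume g: "g \<in> sdp n H"
    assume ex: "\<exists>x1<n. \<exists>x2<n. x1 \<noteq> x2 \<and> act n g x1 = x1 \<and> act n g x2 = x2"
    obtain y m where ym: "g = (y, m)" "y < n" "m \<in> H" using g by (auto simp: sdp_def)
    have "m = 1" using ex affine_fixed_point[OF n0 cop[OF ym(3)], of y] ym(1) by blast
    moreover have "y = 0" using fix1 ex ym \<open>m = 1\<close> by blast
    ultimately show "is_ident n g" using ym id0 by simp
  qed
  moreover have "(is_ident n g \<or> (\<forall>x<n. act n g x \<noteq> x)) \<longleftrightarrow>
        (\<exists>y<n. \<forall>x<n. act n g x = (x + y) mod n)" if g: "g \<in> sdp n H" for g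
  proof -
    obtain y m where ym: "g = (y, m)" "y < n" "m \<in> H" using g by (auto simp: sdp_def)
    show ?thesis
    proof (cases "m = 1")
      case True
      then show ?thesis using ym tr fix1 id0 by metis
    next
      case False
      \<comment> \<open>Comparing the images of 0 and 1 recovers the multiplier, which would be 1
        for a translation.\<close>
      have "\<not> (\<exists>z<n. \<forall>x<n. act n g x = (x + z) mod n)"
      proof
        assume "\<exists>z<n. \<forall>x<n. act n g x = (x + z) mod n"
        then obtain z where z: "\<And>x. x < n \<Longrightarrow> act n (y, m) x = (x + z) mod n"
          using ym by blast
        have "[(0 + y) * m = 0 + z] (mod n)" "[(1 + y) * m = 1 + z] (mod n)"
          using z[of 0] z[of 1] assms(1) by (simp_all add: act_def cong_def)
        then have "[y * m + m = y * m + 1] (mod n)"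
          by (simp add: algebra_simps) (metis add.commute add.left_commute cong_add_lcancel_nat cong_sym cong_trans plus_1_eq_Suc)
        then have "[m = 1] (mod n)" using cong_add_lcancel_nat by blast
        then show False using False mless[OF ym(3)] assms(1) by (simp add: cong_def)
      qed
      then show ?thesis
        using nid[OF ym(3) False] affine_fixed_point[OF n0 cop[OF ym(3) False], of y] ym by blast
    qed
  qed
  ultimately show ?thesis using H by (simp add: frob_group_def)
qed

text \<open>If d = gcd(m - 1, n) exceeded 1, multiplication by m would fix both 0 and n / d, and
  hence be the identity.\<close>

lemma frob_group_coprime:
  assumes "n > 1" "frob_group n H" "m \<in> H" "m \<noteq> 1"
  shows "coprime (int m - 1) (int n)"
proof (rule ccontr)
  assume nc: "\<not> coprime (int m - 1) (int n)"
  define d where "d = gcd (int m - 1) (int n)"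
  have d: "d > 0" "d \<noteq> 1" "d dvd int m - 1" "d dvd int n"
    unfolding d_def using assms(1) nc coprime_iff_gcd_eq_1 by (simp_all add: gcd_pos_int) blast
  then have d1: "d > 1" by linarith
  obtain e where e: "int n = d * e" using d(4) unfolding dvd_def by blast
  have e0: "e > 0"
    using zero_less_mult_pos[of d e] e assms(1) d(1) by simp
  have "1 * e < d * e" using mult_strict_right_mono[OF d1 e0] .
  then have "e < int n" using e by simp
  have x: "nat e < n" "nat e \<noteq> 0" "int (nat e) = e" using e0 \<open>e < int n\<close> by auto
  have m: "m < n" using assms by (auto simp: frob_group_def units_subgroup_def)
  have "int n dvd e * (int m - 1)"
    using e d(3) by (metis mult.commute mult_dvd_mono dvd_refl)
  then have "[(int (nat e) + int 0) * int m = int (nat e)] (mod int n)"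
    using x by (simp add: cong_iff_dvd_diff algebra_simps)
  then have "act n (0, m) (nat e) = nat e" using act_eq_iff x by blast
  moreover have "act n (0, m) 0 = 0" by (simp add: act_def)
  moreover have "(0, m) \<in> sdp n H" using assms by (simp add: sdp_def)
  moreover have "0 < n" using assms by simp
  ultimately have "is_ident n (0, m)"
    using assms(2) x unfolding frob_group_def frobenius_def by blast
  then have "act n (0, m) 1 = 1" using assms(1) by (simp add: is_ident_def)
  then show False using m assms(4) by (simp add: act_def)
qed

section \<open>From a first-kind Frobenius circulant to a root\<close>

lemma units_subgroup_power:
  assumes "units_subgroup n H" "h \<in> H"
  shows "h ^ k mod n \<in> H"
proof (induction k)
  case 0
  then show ?case using assms by (simp add: units_subgroup_def)
next
  case (Suc k)
  then have "h * (h ^ k mod n) mod n \<in> H" using assms by (auto simp: units_subgroup_def)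
  then show ?case by (simp add: mod_mult_right_eq)
qed

text \<open>The connection set is a coset s H. As it contains 1, s is the inverse of some h in H, so
  it lies in H and the coset is H itself.\<close>

lemma first_kind_connection_set:
  assumes "n > 1" "units_subgroup n H" "first_kind n H S" "1 \<in> S"
  shows "S = H"
proof -
  have closed: "x * y mod n \<in> H" if "x \<in> H" "y \<in> H" for x y
    using that assms(2) by (auto simp: units_subgroup_def)
  have less: "x < n" if "x \<in> H" for x
    using that assms(2) by (auto simp: units_subgroup_def)
  obtain s where s: "s < n" "S = (\<lambda>m. (s * m) mod n) ` H"
    using assms(3) by (auto simp: first_kind_def)
  obtain h where h: "h \<in> H" "s * h mod n = 1" using assms(4) s by auto
  have hc: "coprime h n" using h assms(2) by (auto simp: units_subgroup_def)
  \<comment> \<open>\<open>units_subgroup\<close> provides closure under products only, so Euler's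
    theorem is used to write the inverse of \<open>h\<close> as a power of \<open>h\<close>.\<close>
  have "totient n > 0" using assms(1) by simp
  then have "h * h ^ (totient n - 1) = h ^ totient n"
    by (metis Suc_diff_1 power_Suc)
  then have p: "[h * h ^ (totient n - 1) = 1] (mod n)"
    using euler_theorem[OF hc] by simp
  have sh: "[s * h = 1] (mod n)" using h assms(1) by (simp add: cong_def)
  have "[s * (h * h ^ (totient n - 1)) = s * 1] (mod n)" using p cong_scalar_left by blast
  moreover have "[s * h * h ^ (totient n - 1) = 1 * h ^ (totient n - 1)] (mod n)"
    using sh cong_scalar_right by blast
  ultimately have "[s = h ^ (totient n - 1)] (mod n)"
    by (metis cong_sym cong_trans mult.assoc mult_1 mult.right_neutral)
  then have "s = h ^ (totient n - 1) mod n" using s(1) by (simp add: cong_def)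
  then have sH: "s \<in> H" using units_subgroup_power assms(2) h(1) by blast
  have "x \<in> S" if "x \<in> H" for x
  proof -
    have "(s * (h * x mod n)) mod n = (s * h * x) mod n"
      by (simp add: mod_mult_right_eq mult.assoc)
    also have "\<dots> = (1 * x) mod n"
      using sh cong_scalar_right unfolding cong_def by blast
    finally have "x = (s * (h * x mod n)) mod n" using less[OF that] by simp
    then show ?thesis using closed[OF h(1) that] s(2) by blast
  qed
  then show ?thesis using s(2) sH closed by blast
qed

text \<open>\<open>{\<plusminus>1, \<plusminus>A, \<plusminus>B}\<close> has order 6, hence is cyclic, and whichever of \<open>A\<close>, \<open>-A\<close> generates it has
  \<open>t A + 1\<close> invertible and \<open>(t A)\<^sup>3 = -1\<close>, so it is a root of \<open>x\<^sup>2 - x + 1\<close>.\<close>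

lemma six_units_hexroot:
  fixes A B :: int
  defines "V \<equiv> {1, -1, A, -A, B, -B}"
  assumes closed: "\<And>u v. u \<in> V \<Longrightarrow> v \<in> V \<Longrightarrow> \<exists>w\<in>V. [u * v = w] (mod int n)"
    and cop: "\<And>u. u \<in> V \<Longrightarrow> \<not> [u = 1] (mod int n) \<Longrightarrow> coprime (u - 1) (int n)"
    and unit: "coprime A (int n)" "coprime B (int n)"
    and dist: "\<not> [A = 1] (mod int n)" "\<not> [A = -1] (mod int n)" "\<not> [B = 1] (mod int n)"
      "\<not> [B = -1] (mod int n)" "\<not> [A = B] (mod int n)" "\<not> [A = -B] (mod int n)"
  shows "\<exists>s\<in>{1, -1}. \<exists>t\<in>{1, -1}. [B = s * A^2] (mod int n) \<and> hexroot n (t * A)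
    \<and> coprime (t * A + 1) (int n)"
proof -
  have neg: "[x = - y] (mod int n) \<longleftrightarrow> [- x = y] (mod int n)" for x y
    by (metis cong_minus_minus_iff minus_minus)
  have cancelA: "[A * x = A * y] (mod int n) \<longleftrightarrow> [x = y] (mod int n)" for x y
    using unit cong_mult_lcancel by blast
  have cancelB: "[B * x = B * y] (mod int n) \<longleftrightarrow> [x = y] (mod int n)" for x y
    using unit cong_mult_lcancel by blast
  have copA: "coprime (A - 1) (int n)" "coprime (- A - 1) (int n)"
    using cop[of A] cop[of "-A"] dist by (auto simp: V_def neg)
  obtain w where w: "w \<in> V" "[A * A = w] (mod int n)" using closed[of A A] by (auto simp: V_def)
  obtain z where z: "z \<in> V" "[A * B = z] (mod int n)" using closed[of A B] by (auto simp: V_def)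
  \<comment> \<open>If A B were one of A, -A, B, -B, cancelling a unit would make A or B congruent
    to 1 or -1.\<close>
  have z': "z = 1 \<or> z = -1"
  proof -
    have "z \<noteq> A" using z cancelA[of B 1] dist by auto
    moreover have "z \<noteq> -A" using z cancelA[of B "-1"] dist by auto
    moreover have "z \<noteq> B" using z cancelB[of A 1] dist by (auto simp: mult.commute)
    moreover have "z \<noteq> -B" using z cancelB[of A "-1"] dist by (auto simp: mult.commute)
    ultimately show ?thesis using z by (auto simp: V_def)
  qed
  \<comment> \<open>A^2 = 1 would force A = -1, because A - 1 is a unit. A^2 = -1 would give -B = A
    (A B), which is A or -A.\<close>
  have w': "w = B \<or> w = -B"
  proof -
    have "w \<noteq> A" using w cancelA[of A 1] dist by auto
    moreover have "w \<noteq> -A" using w cancelA[of A "-1"] dist by auto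
    moreover have "w \<noteq> 1"
    proof
      assume "w = 1"
      then have "int n dvd (A + 1) * (A - 1)"
        using w by (simp add: cong_iff_dvd_diff algebra_simps)
      then have "int n dvd A + 1"
        using copA(1) by (metis coprime_commute coprime_dvd_mult_left_iff)
      then show False using dist(2) by (simp add: cong_iff_dvd_diff)
    qed
    moreover have "w \<noteq> -1"
    proof
      assume "w = -1"
      then have "[A * A * B = - B] (mod int n)" using cong_scalar_right[OF w(2), of B] by simp
      moreover have "[A * (A * B) = A * z] (mod int n)" using cong_scalar_left[OF z(2)] .
      ultimately have "[A * z = - B] (mod int n)" by (metis cong_sym cong_trans mult.assoc)
      then show False using z' dist by (auto simp: neg)
    qed
    ultimately show ?thesis using w by (auto simp: V_def)
  qed
  obtain s where s: "s = 1 \<or> s = -1" "w = s * B" using w' that[of 1] that[of "-1"] by auto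
  then have Bs: "[B = s * A^2] (mod int n)"
    using w by (auto simp: power2_eq_square neg cong_sym)
  have "[A^3 = A * w] (mod int n)"
    using cong_scalar_left[OF w(2), of A] by (simp add: power3_eq_cube mult.assoc)
  moreover have "[A * w = s * z] (mod int n)"
    using cong_scalar_left[OF z(2), of s] s(2) by (simp add: mult.left_commute)
  ultimately have A3: "[A^3 = s * z] (mod int n)" using cong_trans by blast
  \<comment> \<open>As A^3 = s z, this sign makes (t A)^3 = -1. In the factorisation (t A)^3 + 1 =
    (t A + 1) ((t A)^2 - t A + 1) the linear factor is a unit and cancels.\<close>
  define t where "t = - s * z"
  have t: "t = 1 \<or> t = -1" using s z' by (auto simp: t_def)
  then have "(t * A)^3 = t * A^3" by (auto simp: power_mult_distrib)
  moreover have "[t * A^3 = t * (s * z)] (mod int n)" using A3 cong_scalar_left by blast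
  moreover have "t * (s * z) = -1" using t by (auto simp: t_def)
  ultimately have "[(t * A)^3 = -1] (mod int n)" by simp
  then have "int n dvd (t * A + 1) * ((t * A)^2 - t * A + 1)"
    by (simp add: cong_iff_dvd_diff algebra_simps power2_eq_square power3_eq_cube)
  moreover have c: "coprime (t * A + 1) (int n)"
  proof -
    have "t * A + 1 = - (- A - 1) \<or> t * A + 1 = - (A - 1)" using t by (elim disjE) simp_all
    then show ?thesis using copA by (metis coprime_minus_left_iff)
  qed
  ultimately have "int n dvd (t * A)^2 - t * A + 1"
    by (metis coprime_commute coprime_dvd_mult_right_iff)
  then have "hexroot n (t * A)" by (simp add: cong_0_iff)
  then show ?thesis using Bs c s(1) t by blast
qed

lemma res_hexagon_cong:
  assumes "n > 0" "[a = b] (mod int n)"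
  shows "res n ` hexagon a = res n ` hexagon b"
proof -
  have "res n a = res n b" "res n (- a) = res n (- b)" "res n (a - 1) = res n (b - 1)"
    "res n (1 - a) = res n (1 - b)"
    using assms by (auto simp: res_eq_iff cong_minus_minus_iff intro: cong_diff)
  then show ?thesis by (simp add: hexagon_def)
qed

lemma hexroot_cong:
  assumes "[a = b] (mod int n)"
  shows "hexroot n a \<longleftrightarrow> hexroot n b"
proof -
  have "[a^2 - a + 1 = b^2 - b + 1] (mod int n)"
    using assms by (intro cong_add cong_diff cong_pow cong_refl)
  then show ?thesis by (meson cong_sym cong_trans)
qed

lemma hexroot_square:
  assumes "hexroot n a"
  shows "[a^2 = a - 1] (mod int n)"
proof -
  have "a^2 - a + 1 = a^2 - (a - 1)" by simp
  then show ?thesis using assms by (simp only: cong_iff_dvd_diff diff_zero)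
qed

lemma hexroot_0:
  assumes "n > 1" "hexroot n a"
  shows "\<not> [a = 0] (mod int n)"
proof
  assume "[a = 0] (mod int n)"
  then have "hexroot n 0" using assms(2) hexroot_cong by blast
  then show False using assms(1) by (simp add: cong_0_iff)
qed

text \<open>The given \<open>a\<close> is a root only up to sign, so the root \<open>x\<close> may
  differ from it while the connection set stays the same. That x + 1 is a unit will exclude the
  prime 3. The last clause treats the case in which \<open>a\<close> itself is a root.\<close>

lemma frob_circ_hexroot:
  assumes "n \<ge> 7" "frob_circ n a b H"
  obtains x where "1 \<le> x" "x < n" "hexroot n (int x)" "coprime (int x + 1) (int n)"
    "conn n a b 1 = conn n x (x - 1) 1"
    "hexroot n (int a) \<Longrightarrow> b mod n = (a - 1) mod n \<or> b mod n = negm n (a - 1)"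
proof -
  have n0: "n > 0" and n1: "n > 1" using assms by auto
  have tl: "tl_valid n a b 1" and fg: "frob_group n H" and fk: "first_kind n H (conn n a b 1)"
    using assms(2) by (auto simp: frob_circ_def)
  have us: "units_subgroup n H" using fg by (simp add: frob_group_def)
  define A B where "A = int a" and "B = int b"
  define V where "V = {1, -1, A, -A, B, -B}"
  have S: "conn n a b 1 = res n ` V"
    using conn_eq_res[OF n0, of a b 1] by (auto simp: V_def A_def B_def)
  have "res n 1 = 1" using n1 res_of_nat[of 1 n] by simp
  then have "1 \<in> conn n a b 1" unfolding S V_def by (metis image_eqI insertI1)
  then have HS: "H = res n ` V" using first_kind_connection_set[OF n1 us fk] S by simp
  have closed: "\<exists>w\<in>V. [u * v = w] (mod int n)" if "u \<in> V" "v \<in> V" for u v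
  proof -
    have "(res n u * res n v) mod n \<in> H"
      using that us HS by (auto simp: units_subgroup_def)
    then show ?thesis
      by (auto simp: HS res_mult_mod[OF n0] res_eq_iff[OF n0])
  qed
  have cop: "coprime (u - 1) (int n)" if u: "u \<in> V" "\<not> [u = 1] (mod int n)" for u
  proof -
    have "res n u \<noteq> res n 1" using u n0 by (simp add: res_eq_iff)
    then have "res n u \<noteq> 1" using \<open>res n 1 = 1\<close> by simp
    then have "coprime (int (res n u) - 1) (int n)"
      using frob_group_coprime[OF n1 fg] u HS by blast
    moreover have "[int (res n u) - 1 = u - 1] (mod int n)"
      using res_cong[OF n0] by (intro cong_diff cong_refl)
    ultimately show ?thesis using cong_imp_coprime by blast
  qed
  have unit: "coprime u (int n)" if "u \<in> V" for u
  proof -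
    have "coprime (int (res n u)) (int n)"
      using us HS that by (auto simp: units_subgroup_def)
    then show ?thesis using res_cong[OF n0] cong_imp_coprime by blast
  qed
  have "a \<le> n - 1" "b \<le> n - 1" using tl by (simp_all add: tl_valid_def)
  then have bd: "1 \<le> a" "a < n" "1 \<le> b" "b < n" "distinct [a, b, 1, n - a, n - b, n - 1]"
    using tl n1 by (simp_all add: tl_valid_def)
  have r: "res n A = a" "res n B = b" "res n (-A) = n - a" "res n (-B) = n - b" "res n (-1) = n - 1"
    using bd res_of_nat res_minus_of_nat[of a n] res_minus_of_nat[of b n] res_minus_of_nat[of 1 n]
    by (auto simp: A_def B_def)
  have dist: "\<not> [A = 1] (mod int n)" "\<not> [A = -1] (mod int n)" "\<not> [B = 1] (mod int n)"
      "\<not> [B = -1] (mod int n)" "\<not> [A = B] (mod int n)" "\<not> [A = -B] (mod int n)"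
    unfolding res_eq_iff[OF n0, symmetric] r \<open>res n 1 = 1\<close> using bd(5) by auto
  have "coprime A (int n)" "coprime B (int n)" using unit by (simp_all add: V_def)
  then have "\<exists>s\<in>{1, -1}. \<exists>t\<in>{1, -1}. [B = s * A^2] (mod int n) \<and> hexroot n (t * A)
    \<and> coprime (t * A + 1) (int n)"
    using closed cop dist unfolding V_def by (intro six_units_hexroot)
  then obtain s t where "s \<in> {1, -1}" "t \<in> {1, -1}" and st': "[B = s * A^2] (mod int n)"
    "hexroot n (t * A)" "coprime (t * A + 1) (int n)" by blast
  then have st: "s = 1 \<or> s = -1" "t = 1 \<or> t = -1" "[B = s * A^2] (mod int n)"
    "hexroot n (t * A)" "coprime (t * A + 1) (int n)" by blast+
  define x where "x = res n (t * A)"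
  have x: "[int x = t * A] (mod int n)" unfolding x_def by (rule res_cong[OF n0])
  have xroot: "hexroot n (int x)" using x st(4) hexroot_cong by blast
  have "x \<noteq> 0" using hexroot_0[OF n1 xroot] by (metis cong_refl of_nat_0)
  moreover have "x < n" unfolding x_def by (rule res_less[OF n0])
  moreover have "coprime (int x + 1) (int n)"
    using st(5) x by (metis cong_add cong_imp_coprime cong_refl cong_sym)
  \<comment> \<open>B is A^2 up to sign, and A^2 = (t A)^2 = t A - 1, so the six elements form the
    hexagon of t A.\<close>
  moreover have "conn n a b 1 = conn n x (x - 1) 1"
  proof -
    have "(t * A)^2 = A^2" using st(2) by auto
    then have "[A^2 = t * A - 1] (mod int n)"
      using hexroot_square[OF st(4)] by simp
    then have "[s * A^2 = s * (t * A - 1)] (mod int n)" by (rule cong_scalar_left)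
    then have B: "[B = s * (t * A - 1)] (mod int n)" using st(3) cong_trans by blast
    then have "[- B = - (s * (t * A - 1))] (mod int n)" by (simp only: cong_minus_minus_iff)
    then have "res n ` V = res n ` {1, -1, A, -A, s * (t * A - 1), - (s * (t * A - 1))}"
      using B unfolding res_eq_iff[OF n0, symmetric] V_def by (simp del: mult_minus_left mult_minus_right minus_diff_eq)
    also have "{1, -1, A, -A, s * (t * A - 1), - (s * (t * A - 1))} = hexagon (t * A)"
      using st(1,2) unfolding hexagon_def by auto
    also have "res n ` hexagon (t * A) = res n ` hexagon (int x)"
      using res_hexagon_cong[OF n0] x cong_sym by blast
    finally show ?thesis using S conn_hexagon[OF n0, of x] \<open>x \<noteq> 0\<close> by simp
  qed
  moreover have "b mod n = (a - 1) mod n \<or> b mod n = negm n (a - 1)" if "hexroot n (int a)"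
  proof -
    have "[A^2 = A - 1] (mod int n)"
      using that by (simp add: A_def cong_iff_dvd_diff algebra_simps)
    then have "[s * A^2 = s * (A - 1)] (mod int n)" by (rule cong_scalar_left)
    then have "[B = s * (A - 1)] (mod int n)" using st(3) cong_trans by blast
    then have "res n B = res n (s * (A - 1))" using res_eq_iff[OF n0] by blast
    moreover have "A - 1 = int (a - 1)" using bd by (simp add: A_def)
    ultimately show ?thesis
      using st(1) unfolding negm_eq_res[OF n0] mod_eq_res B_def by auto
  qed
  ultimately show ?thesis using that xroot by (metis One_nat_def Suc_leI gr0I)
qed

text \<open>Modulo 3 the polynomial is (x + 1)^2, so the prime 3 cannot divide n when x + 1 is a
  unit; every other prime is covered by \<open>hexroot_prime\<close>.\<close>

lemma hexroot_prime_factor: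
  assumes "hexroot n x" "coprime (x + 1) (int n)" "prime p" "p dvd n"
  shows "p mod 6 = 1"
proof -
  have pn: "int p dvd int n" using assms(4) by simp
  have root: "hexroot p x" using assms(1) pn cong_dvd_modulus by blast
  have "p \<noteq> 3"
  proof
    assume p: "p = 3"
    have "(x + 1)^2 = x^2 - x + 1 + 3 * x" by (simp add: algebra_simps power2_eq_square)
    moreover have "3 dvd x^2 - x + 1" using root p by (simp add: cong_0_iff)
    ultimately have "3 dvd (x + 1)^2" by (metis dvd_add dvd_triv_left)
    moreover have "prime (3::int)" by simp
    ultimately have "3 dvd x + 1" using prime_dvd_power by blast
    then have "is_unit (3::int)"
      using assms(2) pn p coprime_common_divisor by fastforce
    then show False by simp
  qed
  then show ?thesis using hexroot_prime[OF assms(3) _ root] by blast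
qed

section \<open>From a root to a first-kind Frobenius circulant\<close>

lemma complete_rotation_hexagon:
  assumes "n > 0" "hexroot n a"
  shows "complete_rotation n (res n ` hexagon a) (res n a)"
proof -
  note r = res_mult_mod[OF assms(1)] and m = hexagon_mult[OF assms(2)]
  have ah: "a \<in> hexagon a" by (simp add: hexagon_def)
  have closed: "res n (u * v) \<in> res n ` hexagon a" if "u \<in> hexagon a" "v \<in> hexagon a" for u v
    using m[OF that] res_eq_iff[OF assms(1)] by blast
  have "(\<lambda>x. (res n a * x) mod n) ` (res n ` hexagon a) = res n ` hexagon a"
  proof
    show "(\<lambda>x. (res n a * x) mod n) ` (res n ` hexagon a) \<subseteq> res n ` hexagon a"
      using closed[OF ah] by (auto simp: r)
    show "res n ` hexagon a \<subseteq> (\<lambda>x. (res n a * x) mod n) ` (res n ` hexagon a)"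
    proof
      fix x assume "x \<in> res n ` hexagon a"
      then obtain u where u: "x = res n u" "u \<in> hexagon a" by blast
      obtain v where v: "v \<in> hexagon a" "[a * v = 1] (mod int n)"
        using hexagon_inverse[OF assms(2) ah] by blast
      obtain w where w: "w \<in> hexagon a" "[v * u = w] (mod int n)" using m v u by blast
      have "[a * w = a * (v * u)] (mod int n)" using w cong_scalar_left cong_sym by blast
      moreover have "[a * v * u = 1 * u] (mod int n)" using v cong_scalar_right by blast
      ultimately have "[a * w = u] (mod int n)" by (metis cong_trans mult.assoc mult_1)
      then have "x = (res n a * res n w) mod n" using u assms(1) by (simp add: r res_eq_iff cong_sym)
      then show "x \<in> (\<lambda>x. (res n a * x) mod n) ` (res n ` hexagon a)" using w by blast
    qed
  qed
  \<comment> \<open>The quotient of two hexagon elements is again in the hexagon, hence a power of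
    \<open>a\<close>; so multiplication by \<open>a\<close> acts as a single cycle.\<close>
  moreover have "\<exists>k::nat. (res n a ^ k * x) mod n = y"
    if xy: "x \<in> res n ` hexagon a" "y \<in> res n ` hexagon a" for x y
  proof -
    obtain u v where uv: "u \<in> hexagon a" "v \<in> hexagon a" "x = res n u" "y = res n v"
      using xy by blast
    obtain u' where u': "u' \<in> hexagon a" "[u * u' = 1] (mod int n)"
      using hexagon_inverse[OF assms(2) uv(1)] by blast
    obtain w where w: "w \<in> hexagon a" "[u' * v = w] (mod int n)" using m u' uv by blast
    obtain k where k: "[a ^ k = w] (mod int n)" using hexagon_power[OF assms(2) w(1)] by blast
    have "[int (res n a ^ k * x) = a ^ k * u] (mod int n)"
      unfolding uv of_nat_mult of_nat_power by (intro cong_mult cong_pow res_cong assms(1))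
    also have "[a ^ k * u = u' * v * u] (mod int n)"
      using k w cong_scalar_right cong_sym cong_trans by blast
    also have "u' * v * u = u * u' * v" by simp
    also have "[u * u' * v = 1 * v] (mod int n)" using u' cong_scalar_right by blast
    finally have "(res n a ^ k * x) mod n = y"
      using assms(1) by (simp add: mod_eq_res uv res_eq_iff del: of_nat_mult of_nat_power)
    then show ?thesis by blast
  qed
  ultimately show ?thesis
    using assms res_less coprime_res hexagon_coprime[OF assms(2) ah]
    by (auto simp: complete_rotation_def)
qed

lemma cay_res_iff:
  assumes "n > 0" "x < n" "y < n"
  shows "(x, y) \<in> cay n (res n ` V) \<longleftrightarrow> (\<exists>u\<in>V. [int x - int y = u] (mod int n))"
proof -
  have "int (x + n - y) = int x - int y + int n" using assms by (simp add: of_nat_diff)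
  then have "(x + n - y) mod n = res n (int x - int y)"
    using assms(1) by (simp add: mod_eq_res res_eq_iff cong_iff_dvd_diff)
  then show ?thesis using assms by (auto simp: cay_def res_eq_iff)
qed

lemma cay_less: "(x, y) \<in> cay n S \<Longrightarrow> x < n \<and> y < n"
  by (simp add: cay_def)

text \<open>Elements of the hexagon are invertible within it, so multiplying a difference by one of
  them neither creates nor destroys adjacency.\<close>

lemma hexagon_mult_cancel:
  assumes "hexroot n a" "w \<in> hexagon a"
  shows "(\<exists>u\<in>hexagon a. [d * w = u] (mod int n)) \<longleftrightarrow> (\<exists>u\<in>hexagon a. [d = u] (mod int n))"
proof
  assume "\<exists>u\<in>hexagon a. [d = u] (mod int n)"
  then show "\<exists>u\<in>hexagon a. [d * w = u] (mod int n)"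
    using hexagon_mult[OF assms(1) _ assms(2)] by (meson cong_scalar_right cong_trans)
next
  assume "\<exists>u\<in>hexagon a. [d * w = u] (mod int n)"
  then obtain u where u: "u \<in> hexagon a" "[d * w = u] (mod int n)" by blast
  obtain v where v: "v \<in> hexagon a" "[w * v = 1] (mod int n)"
    using hexagon_inverse[OF assms] by blast
  have "[d * (w * v) = d * 1] (mod int n)" using v cong_scalar_left by blast
  moreover have "[d * w * v = u * v] (mod int n)" using u cong_scalar_right by blast
  ultimately have "[d = u * v] (mod int n)" by (metis cong_sym cong_trans mult.assoc mult.right_neutral)
  then show "\<exists>u\<in>hexagon a. [d = u] (mod int n)"
    using hexagon_mult[OF assms(1) u(1) v(1)] cong_trans by blast
qed

text \<open>Translations cancel in differences, so only the multiplier affects adjacency. An arc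
  with difference u goes to one with difference v by the multiplier v / u and a translation matching
  the first endpoints.\<close>

lemma arc_transitive_hexagon:
  assumes "n > 0" "hexroot n a"
  shows "arc_transitive n (res n ` hexagon a) (cay n (res n ` hexagon a))"
  unfolding arc_transitive_def
proof (intro conjI ballI allI impI)
  fix g assume "g \<in> sdp n (res n ` hexagon a)"
  then obtain y w where g: "g = (y, res n w)" "y < n" "w \<in> hexagon a"
    by (auto simp: sdp_def)
  have ac: "[int (act n g x) = (int x + int y) * w] (mod int n)" for x
  proof -
    have "[(int x + int y) * int (res n w) = (int x + int y) * w] (mod int n)"
      using res_cong[OF assms(1)] cong_scalar_left by blast
    then show ?thesis using act_cong[OF assms(1), of y "res n w" x] g(1) cong_trans by blast
  qed
  have diff: "[int (act n g x) - int (act n g x') = (int x - int x') * w] (mod int n)" for x x'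
    using cong_diff[OF ac[of x] ac[of x']] by (simp add: algebra_simps)
  have "inj_on (act n g) {0..<n}"
  proof
    fix x x' assume x: "x \<in> {0..<n}" "x' \<in> {0..<n}" "act n g x = act n g x'"
    then have "int n dvd (int x - int x') * w"
      using diff[of x x'] by (simp add: cong_iff_dvd_diff)
    then have "int n dvd int x - int x'"
      using hexagon_coprime[OF assms(2) g(3)] coprime_commute coprime_dvd_mult_left_iff by blast
    then show "x = x'"
      using x by (metis atLeastLessThan_iff cong_iff_dvd_diff cong_int_iff cong_less_modulus_unique_nat)
  qed
  moreover have "act n g ` {0..<n} \<subseteq> {0..<n}" using act_less[OF assms(1), of g] by auto
  ultimately show "bij_betw (act n g) {0..<n} {0..<n}"
    by (simp add: bij_betw_def endo_inj_surj)
  fix x x' assume x: "x < n" "x' < n"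
  have "(\<exists>u\<in>hexagon a. [int (act n g x) - int (act n g x') = u] (mod int n)) \<longleftrightarrow>
      (\<exists>u\<in>hexagon a. [(int x - int x') * w = u] (mod int n))"
    using diff[of x x'] by (simp add: cong_def)
  then show "(x, x') \<in> cay n (res n ` hexagon a) \<longleftrightarrow>
      (act n g x, act n g x') \<in> cay n (res n ` hexagon a)"
    using x act_less[OF assms(1)] by (simp add: cay_res_iff assms(1) hexagon_mult_cancel[OF assms(2) g(3)])
next
  fix p q assume pq: "p \<in> cay n (res n ` hexagon a)" "q \<in> cay n (res n ` hexagon a)"
  obtain x y x' y' where xy: "p = (x, y)" "q = (x', y')" by (metis surj_pair)
  have less: "x < n" "y < n" "x' < n" "y' < n" using pq xy cay_less by blast+
  have "\<exists>u\<in>hexagon a. [int x - int y = u] (mod int n)" "\<exists>v\<in>hexagon a. [int x' - int y' = v] (mod int n)"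
    using pq unfolding xy cay_res_iff[OF assms(1) less(1,2)] cay_res_iff[OF assms(1) less(3,4)] .
  then obtain u v where uv: "u \<in> hexagon a" "[int x - int y = u] (mod int n)"
    "v \<in> hexagon a" "[int x' - int y' = v] (mod int n)" by blast
  obtain u' where u': "u' \<in> hexagon a" "[u * u' = 1] (mod int n)"
    using hexagon_inverse[OF assms(2) uv(1)] by blast
  obtain w where w: "w \<in> hexagon a" "[u' * v = w] (mod int n)"
    using hexagon_mult[OF assms(2) u'(1) uv(3)] by blast
  obtain w' where w': "w' \<in> hexagon a" "[w * w' = 1] (mod int n)"
    using hexagon_inverse[OF assms(2) w(1)] by blast
  \<comment> \<open>Chosen so that (x + z) w = x', with \<open>w'\<close> the inverse of
    \<open>w\<close>. The next fact gives the image of any vertex \<open>t\<close>, to be used at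
    \<open>x\<close> and at \<open>y\<close>.\<close>
  define z where "z = int x' * w' - int x"
  have main: "[(int t + int (res n z)) * int (res n w) = int x' - (int x - int t) * w] (mod int n)" for t
  proof -
    have "[(int t + int (res n z)) * int (res n w) = (int t + z) * w] (mod int n)"
      by (intro cong_mult cong_add cong_refl res_cong assms(1))
    also have "(int t + z) * w = int x' * (w * w') - (int x - int t) * w"
      by (simp add: z_def algebra_simps)
    also have "[\<dots> = int x' * 1 - (int x - int t) * w] (mod int n)"
      using w'(2) by (intro cong_diff cong_mult cong_refl)
    finally show ?thesis by simp
  qed
  have "[(int x - int y) * w = u * (u' * v)] (mod int n)"
    using uv(2) w(2) by (intro cong_mult) (auto simp: cong_sym)
  also have "u * (u' * v) = u * u' * v" by simp
  also have "[u * u' * v = 1 * v] (mod int n)" using u'(2) cong_scalar_right by blast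
  also have "[1 * v = int x' - int y'] (mod int n)" using uv(4) by (simp add: cong_sym)
  finally have "[int x' - (int x - int y) * w = int x' - (int x' - int y')] (mod int n)"
    by (intro cong_diff cong_refl)
  then have "act n (res n z, res n w) y = y'" using main[of y] less(4) act_eq_iff cong_trans by fastforce
  moreover have "act n (res n z, res n w) x = x'" using main[of x] less(3) act_eq_iff by simp
  moreover have "(res n z, res n w) \<in> sdp n (res n ` hexagon a)"
    using w(1) res_less[OF assms(1)] by (simp add: sdp_def)
  ultimately show "\<exists>g\<in>sdp n (res n ` hexagon a). act n g (fst p) = fst q \<and> act n g (snd p) = snd q"
    using xy by (metis fst_conv snd_conv)
qed

lemma cyc_hexagon:
  assumes "n > 0" "hexroot n (int a)"
  shows "cyc n a = res n ` hexagon (int a)"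
proof -
  have "cyc n a = range (\<lambda>k. res n (int a ^ k))"
    by (auto simp: cyc_def mod_eq_res)
  also have "\<dots> = res n ` hexagon (int a)"
  proof
    have "int a \<in> hexagon (int a)" by (simp add: hexagon_def)
    then have "\<exists>w\<in>hexagon (int a). res n (int a ^ k) = res n w" for k
      using power_hexagon[OF assms(2)] res_eq_iff[OF assms(1)] by blast
    then show "range (\<lambda>k. res n (int a ^ k)) \<subseteq> res n ` hexagon (int a)" by auto
    have "\<exists>k. res n u = res n (int a ^ k)" if "u \<in> hexagon (int a)" for u
      using hexagon_power[OF assms(2) that] res_eq_iff[OF assms(1)] by metis
    then show "res n ` hexagon (int a) \<subseteq> range (\<lambda>k. res n (int a ^ k))" by auto
  qed
  finally show ?thesis .
qed

lemma units_subgroup_hexagon: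
  assumes "n > 0" "hexroot n a"
  shows "units_subgroup n (res n ` hexagon a)"
proof -
  have "1 mod n = res n 1" using mod_eq_res[of 1 n] by simp
  moreover have "(1::int) \<in> hexagon a" by (simp add: hexagon_def)
  ultimately have "1 mod n \<in> res n ` hexagon a" by blast
  moreover have "(x * y) mod n \<in> res n ` hexagon a"
    if xy: "x \<in> res n ` hexagon a" "y \<in> res n ` hexagon a" for x y
  proof -
    obtain u v where uv: "u \<in> hexagon a" "v \<in> hexagon a" "x = res n u" "y = res n v"
      using xy by blast
    then obtain w where "w \<in> hexagon a" "res n (u * v) = res n w"
      using hexagon_mult[OF assms(2)] res_eq_iff[OF assms(1)] by blast
    then show ?thesis using uv by (simp add: res_mult_mod[OF assms(1)])
  qed
  moreover have "res n ` hexagon a \<subseteq> {m. m < n \<and> coprime m n}"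
    using assms res_less coprime_res hexagon_coprime by auto
  ultimately show ?thesis by (auto simp: units_subgroup_def)
qed

text \<open>Any coincidence among the six entries would make n divide some u + v a of norm 1, 3 or
  4, which is impossible for n at least 7.\<close>

lemma hexroot_tl_valid:
  assumes "n \<ge> 7" "1 \<le> a" "a < n" "hexroot n (int a)"
  shows "tl_valid n a (a - 1) 1"
proof -
  have nz: "\<not> int n dvd u + v * int a" if "u^2 + u*v + v^2 \<in> {1,3,4}" for u v
    using that assms(1) by (intro hexroot_nonzero[OF assms(4)]) auto
  have "a \<noteq> 1" using nz[of "-1" 1] by auto
  moreover have "a \<noteq> 2" using nz[of "-2" 1] by auto
  moreover have "2 * a \<noteq> n"
  proof
    assume "2 * a = n" then have "int n = 0 + 2 * int a" by simp
    then show False using nz[of 0 2] by simp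
  qed
  moreover have "2 * a \<noteq> n + 1"
  proof
    assume "2 * a = n + 1" then have "int n = -1 + 2 * int a" by simp
    then show False using nz[of "-1" 2] by simp
  qed
  moreover have "2 * a \<noteq> n + 2"
  proof
    assume "2 * a = n + 2" then have "int n = -2 + 2 * int a" by simp
    then show False using nz[of "-2" 2] by simp
  qed
  moreover have "a + 1 \<noteq> n"
  proof
    assume "a + 1 = n" then have "int n = 1 + 1 * int a" by simp
    then show False using nz[of 1 1] by simp
  qed
  ultimately have nn: "a \<noteq> 1" "a \<noteq> 2" "2 * a \<noteq> n" "2 * a \<noteq> n + 1" "2 * a \<noteq> n + 2" "a + 1 \<noteq> n"
    by blast+
  have a: "3 \<le> a" "a + 2 \<le> n" using nn(1,2,6) assms(2,3) by linarith+
  have "a \<noteq> n - a" "a \<noteq> n - (a - 1)" "a - 1 \<noteq> n - a" "a - 1 \<noteq> n - (a - 1)"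
    using nn(3,4,5) a by linarith+
  moreover have "a \<noteq> a - 1" "a \<noteq> n - 1" "a - 1 \<noteq> 1" "a - 1 \<noteq> n - 1" "1 \<noteq> n - a"
      "1 \<noteq> n - (a - 1)" "1 \<noteq> n - 1" "n - a \<noteq> n - (a - 1)" "n - a \<noteq> n - 1" "n - (a - 1) \<noteq> n - 1"
    using a by linarith+
  moreover have "1 \<le> a" "a \<le> n - 1" "1 \<le> a - 1" "a - 1 \<le> n - 1" "1 \<le> n - 1"
    using a by linarith+
  ultimately show ?thesis using nn(1) by (simp add: tl_valid_def)
qed

lemma hexagon_circulant:
  assumes "n \<ge> 7" "coprime n 6" "1 \<le> a" "a < n" "hexroot n (int a)"
  defines "H \<equiv> cyc n a" and "S \<equiv> conn n a (a - 1) 1"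
  shows "S = res n ` hexagon (int a)" "H = S"
    "frob_circ n a (a - 1) H" "rotational n S" "geometric n a (a - 1) 1"
    "arc_transitive n H (cay n S)"
    "complete_rotation n S a" "complete_rotation n S (negm n (a^2))"
    "H = {1, n - 1, a, n - a, (a ^ 2) mod n, negm n (a ^ 2)}"
    "H = {1, n - 1, a, n - a, a - 1, n - (a - 1)}"
proof -
  have n0: "n > 0" using assms by simp
  show S: "S = res n ` hexagon (int a)" unfolding S_def by (rule conn_hexagon[OF n0 assms(3)])
  then show HS: "H = S" using cyc_hexagon[OF n0 assms(5)] by (simp add: H_def)
  have tl: "tl_valid n a (a - 1) 1" by (rule hexroot_tl_valid[OF assms(1,3,4,5)])
  have "1 \<le> a - 1" using tl by (simp add: tl_valid_def)
  then have a2: "2 \<le> a" by simp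
  have r: "res n 1 = 1" "res n (-1) = n - 1" "res n (int a) = a" "res n (- int a) = n - a"
     "res n (int a - 1) = a - 1" "res n (1 - int a) = n - (a - 1)"
    using assms a2 res_of_nat[of 1 n] res_minus_of_nat[of 1 n] res_of_nat[of a n] res_minus_of_nat[of a n]
      res_of_nat[of "a - 1" n] res_minus_of_nat[of "a - 1" n] by (simp_all add: of_nat_diff)
  show H1: "H = {1, n - 1, a, n - a, a - 1, n - (a - 1)}"
    unfolding HS S hexagon_def by (simp add: r del: One_nat_def)
  have "[int (a^2) = int a - 1] (mod int n)"
    using assms(5) by (simp add: cong_iff_dvd_diff algebra_simps)
  then have sq: "(a^2) mod n = a - 1" "negm n (a^2) = n - (a - 1)"
    using r(5,6) cong_minus_minus_iff[of "int (a^2)" "int a - 1" "int n"]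
    unfolding mod_eq_res negm_eq_res[OF n0] by (metis res_eq_iff[OF n0] minus_diff_eq)+
  show "H = {1, n - 1, a, n - a, (a ^ 2) mod n, negm n (a ^ 2)}"
    using H1 sq by simp
  show rot: "complete_rotation n S a"
    using complete_rotation_hexagon[OF n0 assms(5)] S r(3) by simp
  show "rotational n S" using rot by (auto simp: rotational_def)
  \<comment> \<open>Modulo n, -a^2 is 1 - a, the conjugate root, and conjugate roots share the same
    hexagon.\<close>
  show "complete_rotation n S (negm n (a^2))"
    using complete_rotation_hexagon[OF n0 hexroot_conj[OF assms(5)]] S r(6) sq
    by (simp add: hexagon_conj)
  show "arc_transitive n H (cay n S)"
    using arc_transitive_hexagon[OF n0 assms(5)] HS S by simp
  \<comment> \<open>The geometric relation is -a + (a - 1) + 1 = 0.\<close>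
  have "(n - a) + (a - 1) + (n - (n - 1)) = n" using assms by simp
  then have "(n - a) + (a - 1) + 1 = n" using assms by simp
  then show "geometric n a (a - 1) 1"
    unfolding geometric_def by (intro bexI[of _ "n - a"] bexI[of _ "a - 1"] bexI[of _ 1]) auto
  have us: "units_subgroup n H"
    using units_subgroup_hexagon[OF n0 assms(5)] HS S by simp
  have "coprime (int m - 1) (int n)" if m: "m \<in> H" "m \<noteq> 1" for m
  proof -
    obtain u where u: "u \<in> hexagon (int a)" "m = res n u" using m HS S by auto
    then have "u \<noteq> 1" using m r(1) by auto
    then have "coprime (u - 1) (int n)" using hexagon_coprime_diff assms(2,5) u by blast
    moreover have "[u - 1 = int m - 1] (mod int n)"
      using res_cong[OF n0] u by (intro cong_diff cong_refl) (simp add: cong_sym)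
    ultimately show ?thesis using cong_imp_coprime by blast
  qed
  then have fg: "frob_group n H"
    using us H1 assms(1) by (intro frob_groupI) auto
  have "card H = 6" using tl by (auto simp: H1 tl_valid_def)
  moreover have sub: "S \<subseteq> {0..<n}" using us HS by (auto simp: units_subgroup_def)
  moreover have "1 \<in> S" using H1 HS by blast
  then have "gen n S = {0..<n}"
    using sub assms(1) by (intro gen_eq_full) auto
  moreover have "(\<lambda>m. (1 * m) mod n) ` H = id ` S"
    using sub HS by (intro image_cong) auto
  moreover have "even (6::nat)" by simp
  ultimately have "first_kind n H S"
    unfolding first_kind_def using assms(1) by (intro exI[of _ 1]) auto
  then show "frob_circ n a (a - 1) H"
    using tl fg by (simp add: frob_circ_def S_def)
qed

section \<open>Rigidity of the graphs\<close>

text \<open>Adjacency depends only on the difference of two vertices, so it is expressed as a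
  property of one integer, insensitive to the choice of representatives.\<close>

definition hexadj :: "nat \<Rightarrow> int \<Rightarrow> int \<Rightarrow> bool" where
  "hexadj n a d \<longleftrightarrow> (\<exists>u\<in>hexagon a. [d = u] (mod int n))"

lemma hexadj_cong:
  assumes "[d = e] (mod int n)"
  shows "hexadj n a d \<longleftrightarrow> hexadj n a e"
  using assms by (simp add: hexadj_def cong_def)

lemma hexadj_hexagon: "u \<in> hexagon a \<Longrightarrow> hexadj n a u"
  unfolding hexadj_def by (intro bexI[of _ u] cong_refl)

lemma hexadj_mult:
  assumes "hexroot n a" "w \<in> hexagon a"
  shows "hexadj n a (d * w) \<longleftrightarrow> hexadj n a d"
  unfolding hexadj_def by (rule hexagon_mult_cancel[OF assms])

text \<open>The pairs (u, v) are the coordinates of the hexagon with respect to 1 and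
  \<open>a\<close>. A difference of norm at most 7 is excluded because n > 7. The difference 3 has
  norm 9, which may be at least n, and is handled directly.\<close>

lemma not_hexadj:
  assumes "n > 7" "hexroot n a"
    and "\<forall>(u, v)\<in>{(1,0), (-1,0), (0,1), (0,-1), (-1,1), (1,-1)}.
      (x - u, y - v) = (3, 0) \<or> (x - u)^2 + (x - u) * (y - v) + (y - v)^2 \<in> {1,3,4,7}"
  shows "\<not> hexadj n a (x + y * a)"
proof
  assume "hexadj n a (x + y * a)"
  then obtain w where w: "w \<in> hexagon a" "[x + y * a = w] (mod int n)"
    by (auto simp: hexadj_def)
  then obtain u v where uv: "(u, v) \<in> {(1,0), (-1,0), (0,1), (0,-1), (-1,1), (1,-1)}"
    "w = u + v * a"
    unfolding hexagon_def by fastforce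
  have d: "int n dvd (x - u) + (y - v) * a"
    using w(2) uv(2) by (simp add: cong_iff_dvd_diff algebra_simps)
  have "(x - u, y - v) = (3, 0) \<or> (x - u)^2 + (x - u) * (y - v) + (y - v)^2 \<in> {1,3,4,7}"
    using bspec[OF assms(3) uv(1)] by simp
  then show False
  proof
    assume "(x - u, y - v) = (3, 0)"
    then have "int n dvd 3" using d by simp
    then show False using assms(1) zdvd_imp_le[of "int n" 3] by simp
  next
    assume "(x - u)^2 + (x - u) * (y - v) + (y - v)^2 \<in> {1,3,4,7}"
    then have "(x - u)^2 + (x - u) * (y - v) + (y - v)^2 \<noteq> 0"
      "(x - u)^2 + (x - u) * (y - v) + (y - v)^2 < int n"
      using assms(1) by (elim insertE emptyE; simp)+
    then show False using hexroot_nonzero[OF assms(2)] d by blast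
  qed
qed

text \<open>Among the neighbours of a vertex, the antipode of \<open>s\<close> is the only one that is neither \<open>s\<close>, nor adjacent
  to \<open>s\<close>, nor joined to \<open>s\<close> by a common neighbour in the hexagon. This makes \<open>s \<mapsto> -s\<close> a graph
  invariant; for \<open>n = 7\<close> the graph is complete and this fails.\<close>

definition antipodal :: "nat \<Rightarrow> int \<Rightarrow> int \<Rightarrow> int \<Rightarrow> bool" where
  "antipodal n a s t \<longleftrightarrow> \<not> [s = t] (mod int n) \<and> \<not> hexadj n a (s - t) \<and>
     (\<forall>r. hexadj n a r \<longrightarrow> \<not> (hexadj n a (r - s) \<and> hexadj n a (r - t)))"

text \<open>For each u in the hexagon, u - 1 or u + 1 is one of 0, 1 + a, -1 - a, a - 2, 2 - a, none
  of which is a neighbour of 0.\<close>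

lemma antipodal_1:
  assumes "n > 7" "hexroot n a"
  shows "antipodal n a 1 (-1)"
proof -
  note nh = not_hexadj[OF assms]
  have h: "\<not> hexadj n a 0" "\<not> hexadj n a 2" "\<not> hexadj n a (1 + a)" "\<not> hexadj n a (-1 - a)"
      "\<not> hexadj n a (a - 2)" "\<not> hexadj n a (2 - a)"
    using nh[of 0 0] nh[of 2 0] nh[of 1 1] nh[of "-1" "-1"] nh[of "-2" 1] nh[of 2 "-1"]
    by simp_all
  have "\<not> (hexadj n a (r - 1) \<and> hexadj n a (r + 1))" if r: "hexadj n a r" for r
  proof
    assume H: "hexadj n a (r - 1) \<and> hexadj n a (r + 1)"
    obtain u where u: "u \<in> hexagon a" "[r = u] (mod int n)" using r by (auto simp: hexadj_def)
    have "[r - 1 = u - 1] (mod int n)" "[r + 1 = u + 1] (mod int n)"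
      by (intro cong_diff cong_add cong_refl u(2))+
    then have "hexadj n a (u - 1)" "hexadj n a (u + 1)" using H hexadj_cong by blast+
    moreover have "- a - 1 = - 1 - a" "1 - a + 1 = 2 - a" "a - 1 - 1 = a - 2" "a + 1 = 1 + a"
      by simp_all
    ultimately show False
      using u(1) h unfolding hexagon_def by (elim insertE emptyE) simp_all
  qed
  moreover have "\<not> [1 = - 1] (mod int n)"
    using assms(1) zdvd_imp_le[of "int n" 2] by (auto simp: cong_iff_dvd_diff)
  ultimately show ?thesis using h(2) by (simp add: antipodal_def)
qed

lemma antipodal_cong:
  assumes "[s = s'] (mod int n)" "[t = t'] (mod int n)"
  shows "antipodal n a s t \<longleftrightarrow> antipodal n a s' t'"
proof -
  have "hexadj n a (s - t) \<longleftrightarrow> hexadj n a (s' - t')"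
    using assms by (intro hexadj_cong cong_diff)
  moreover have "hexadj n a (r - s) \<longleftrightarrow> hexadj n a (r - s')"
    "hexadj n a (r - t) \<longleftrightarrow> hexadj n a (r - t')" for r
    by (intro hexadj_cong cong_diff cong_refl assms)+
  moreover have "[s = t] (mod int n) \<longleftrightarrow> [s' = t'] (mod int n)"
    using assms by (simp add: cong_def)
  ultimately show ?thesis by (simp add: antipodal_def)
qed

text \<open>Dividing by s reduces to s = 1. Then a and 1 - a are adjacent to 1, while a - 1 and -a
  are joined to 1 through a and 1 - a respectively; only -1 remains.\<close>

lemma antipodal_imp_minus:
  assumes "hexroot n a" "hexadj n a s" "hexadj n a t" "antipodal n a s t"
  shows "[t = - s] (mod int n)"
proof -
  obtain u where u: "u \<in> hexagon a" "[s = u] (mod int n)" using assms(2) by (auto simp: hexadj_def)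
  obtain v where v: "v \<in> hexagon a" "[u * v = 1] (mod int n)"
    using hexagon_inverse[OF assms(1) u(1)] by blast
  have "hexadj n a (t * v)" using hexadj_mult[OF assms(1) v(1)] assms(3) by simp
  then obtain w where w: "w \<in> hexagon a" "[t * v = w] (mod int n)" by (auto simp: hexadj_def)
  have "[t * (u * v) = t * 1] (mod int n)" using v(2) cong_scalar_left by blast
  moreover have "[t * v * u = w * u] (mod int n)" using w(2) cong_scalar_right by blast
  ultimately have t: "[t = w * u] (mod int n)"
    by (metis cong_sym cong_trans mult.assoc mult.commute mult.right_neutral)
  have ap: "antipodal n a u (w * u)" using assms(4) antipodal_cong[OF u(2) t] by simp
  have "\<not> hexadj n a ((1 - w) * u)" using ap by (simp add: antipodal_def algebra_simps)
  then have 1: "\<not> hexadj n a (1 - w)" using hexadj_mult[OF assms(1) u(1)] by simp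
  have 2: "\<not> (hexadj n a (r - 1) \<and> hexadj n a (r - w))" if "r \<in> hexagon a" for r
  proof -
    have "hexadj n a (r * u)" using that hexadj_hexagon hexadj_mult[OF assms(1) u(1)] by blast
    then have "\<not> (hexadj n a (r * u - u) \<and> hexadj n a (r * u - w * u))"
      using ap by (simp add: antipodal_def)
    moreover have "r * u - u = (r - 1) * u" "r * u - w * u = (r - w) * u"
      by (simp_all add: algebra_simps)
    ultimately show ?thesis using hexadj_mult[OF assms(1) u(1)] by metis
  qed
  have "w \<noteq> 1" using ap by (auto simp: antipodal_def)
  moreover have "w \<noteq> a" using 1 hexadj_hexagon[of "1 - a" a n] by (auto simp: hexagon_def)
  moreover have "w \<noteq> 1 - a" using 1 hexadj_hexagon[of "a" a n] by (auto simp: hexagon_def)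
  moreover have "w \<noteq> a - 1"
    using 2[of a] hexadj_hexagon[of "a - 1" a n] hexadj_hexagon[of 1 a n] by (auto simp: hexagon_def)
  moreover have "w \<noteq> - a"
    using 2[of "1 - a"] hexadj_hexagon[of "- a" a n] hexadj_hexagon[of 1 a n] by (auto simp: hexagon_def)
  ultimately have "w = -1" using w(1) by (auto simp: hexagon_def)
  then show ?thesis using t u(2) by (metis cong_minus_minus_iff cong_sym cong_trans mult_minus1)
qed

text \<open>At 1, -1, -b and b - 1 the polynomial is congruent to 1, 3, 2b and 2 - 2b, and n divides
  none of these.\<close>

lemma hexroot_in_hexagon:
  assumes "n > 7" "hexroot n b" "hexroot n w" "w \<in> hexagon b"
  shows "w = b \<or> w = 1 - b"
proof -
  have nz: "\<not> int n dvd u + v * b" if "u^2 + u*v + v^2 \<in> {1,3,4}" for u v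
    using that assms(1) by (intro hexroot_nonzero[OF assms(2)]) auto
  have d: "int n dvd w^2 - w + 1" "int n dvd b^2 - b + 1" using assms(2,3) by (simp_all add: cong_0_iff)
  have "w \<noteq> 1" using d(1) nz[of 1 0] by auto
  moreover have "w \<noteq> -1" using d(1) assms(1) zdvd_imp_le[of "int n" 3] by auto
  moreover have "w \<noteq> - b"
  proof
    assume "w = - b"
    then have "w^2 - w + 1 = (b^2 - b + 1) + 2 * b" by (simp add: algebra_simps)
    then have "int n dvd 2 * b" using d by (metis dvd_add_right_iff)
    then show False using nz[of 0 2] by simp
  qed
  moreover have "w \<noteq> b - 1"
  proof
    assume "w = b - 1"
    moreover have "(b - 1)^2 - (b - 1) + 1 = (b^2 - b + 1) + (2 + (-2) * b)"
      by (simp add: algebra_simps power2_eq_square)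
    ultimately have "w^2 - w + 1 = (b^2 - b + 1) + (2 + (-2) * b)" by simp
    then have "int n dvd 2 + (-2) * b" using d by (metis dvd_add_right_iff)
    then show False using nz[of 2 "-2"] by simp
  qed
  ultimately show ?thesis using assms(4) by (auto simp: hexagon_def)
qed

text \<open>An isomorphism preserves antipodes, so \<open>F (x + 1) + F (x - 1) = 2 F x\<close> for all \<open>x\<close>: it is affine.\<close>

lemma hexagon_graph_rigid:
  fixes F :: "int \<Rightarrow> int"
  assumes "n > 7" "hexroot n (int a)" "hexroot n b"
    and inj: "\<And>x y. [F x = F y] (mod int n) \<longleftrightarrow> [x = y] (mod int n)"
    and surj: "\<And>z. \<exists>x. [F x = z] (mod int n)"
    and adj: "\<And>x y. hexadj n b (F x - F y) \<longleftrightarrow> hexadj n (int a) (x - y)"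
  shows "[int a = b] (mod int n) \<or> [int a = 1 - b] (mod int n)"
proof -
  have one: "hexadj n (int a) 1" "hexadj n (int a) (-1)"
    by (simp_all add: hexadj_hexagon hexagon_def)
  have ap1: "antipodal n (int a) 1 (-1)" by (rule antipodal_1[OF assms(1,2)])
  have step: "[F (x - 1) - F x = - (F (x + 1) - F x)] (mod int n)" for x
  proof (rule antipodal_imp_minus[OF assms(3)])
    show "hexadj n b (F (x + 1) - F x)" "hexadj n b (F (x - 1) - F x)"
      using one by (simp_all add: adj)
    have "\<not> [F (x + 1) - F x = F (x - 1) - F x] (mod int n)"
    proof
      assume "[F (x + 1) - F x = F (x - 1) - F x] (mod int n)"
      then have "[F (x + 1) = F (x - 1)] (mod int n)"
        by (simp add: cong_iff_dvd_diff)
      then have "[x + 1 = x - 1] (mod int n)" using inj by blast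
      then have "[1 = - 1] (mod int n)" by (simp add: cong_iff_dvd_diff)
      then show False using ap1 by (simp add: antipodal_def)
    qed
    moreover have "\<not> hexadj n b ((F (x + 1) - F x) - (F (x - 1) - F x))"
      using ap1 adj[of "x + 1" "x - 1"] by (simp add: antipodal_def)
    moreover have "\<not> (hexadj n b (r - (F (x + 1) - F x)) \<and> hexadj n b (r - (F (x - 1) - F x)))"
      if r: "hexadj n b r" for r
    proof -
      \<comment> \<open>A possible common neighbour in the image is pulled back to \<open>y\<close>,
        where the antipodality of 1 and -1 applies.\<close>
      obtain y where "[F y = r + F x] (mod int n)" using surj by blast
      then have y: "[r = F y - F x] (mod int n)"
        by (simp add: cong_iff_dvd_diff algebra_simps dvd_diff_commute)
      have e: "hexadj n b (r - d) \<longleftrightarrow> hexadj n b (F y - F x - d)" for d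
        using y by (intro hexadj_cong cong_diff cong_refl)
      have "hexadj n (int a) (y - x)" using r hexadj_cong[OF y] adj by blast
      then have "\<not> (hexadj n (int a) (y - x - 1) \<and> hexadj n (int a) (y - x + 1))"
        using ap1 by (simp add: antipodal_def)
      moreover have "F y - F x - (F z - F x) = F y - F z" for z by simp
      moreover have "y - (x + 1) = y - x - 1" "y - (x - 1) = y - x + 1" by simp_all
      ultimately show ?thesis using e adj by metis
    qed
    ultimately show "antipodal n b (F (x + 1) - F x) (F (x - 1) - F x)"
      by (simp add: antipodal_def)
  qed
  define u where "u = F 1 - F 0"
  \<comment> \<open>The recurrence from \<open>step\<close> is of second order, so the induction
    carries two consecutive values.\<close>
  have affine: "[F (int k) = F 0 + int k * u] (mod int n) \<and>
      [F (int (Suc k)) = F 0 + int (Suc k) * u] (mod int n)" for k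
  proof (induction k)
    case 0
    then show ?case by (simp add: u_def)
  next
    case (Suc k)
    let ?x = "int (Suc k)"
    have "F (?x + 1) - (2 * F ?x - F (?x - 1)) = (F (?x - 1) - F ?x) - (- (F (?x + 1) - F ?x))"
      by simp
    then have "[F (?x + 1) = 2 * F ?x - F (?x - 1)] (mod int n)"
      using step[of ?x] unfolding cong_iff_dvd_diff by (simp only:)
    also have "[2 * F ?x - F (?x - 1) = 2 * (F 0 + ?x * u) - (F 0 + int k * u)] (mod int n)"
      using Suc by (intro cong_diff cong_mult cong_refl) (auto simp: add.commute)
    finally show ?case using Suc by (simp add: algebra_simps)
  qed
  have "hexadj n b u" using one(1) adj[of 1 0] by (simp add: u_def)
  then obtain w where w: "w \<in> hexagon b" "[u = w] (mod int n)" by (auto simp: hexadj_def)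
  \<comment> \<open>The edge between 0 and \<open>a\<close> goes to one with difference a u. As u is
    congruent to an element of the hexagon of \<open>b\<close>, cancelling it places
    \<open>a\<close> there too.\<close>
  have "hexadj n (int a) (int a - 0)" by (simp add: hexadj_hexagon hexagon_def)
  then have "hexadj n b (F (int a) - F 0)" using adj by blast
  moreover have "[F (int a) - F 0 = F 0 + int a * u - F 0] (mod int n)"
    using affine by (intro cong_diff cong_refl) blast
  moreover have "[F 0 + int a * u - F 0 = int a * w] (mod int n)"
    using cong_scalar_left[OF w(2)] by simp
  ultimately have "hexadj n b (int a * w)" using hexadj_cong cong_trans by blast
  then have "hexadj n b (int a)" using hexadj_mult[OF assms(3) w(1)] by simp
  then obtain v where v: "v \<in> hexagon b" "[int a = v] (mod int n)" by (auto simp: hexadj_def)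
  then have "hexroot n v" using assms(2) hexroot_cong by blast
  then show ?thesis using hexroot_in_hexagon[OF assms(1,3) _ v(1)] v(2) by blast
qed

lemma graph_iso_hexroot:
  assumes "n > 7" "1 \<le> a" "1 \<le> b" "hexroot n (int a)" "hexroot n (int b)"
    and iso: "graph_iso n (cay n (conn n a (a - 1) 1)) (cay n (conn n b (b - 1) 1))"
  shows "[int a = int b] (mod int n) \<or> [int a = 1 - int b] (mod int n)"
proof -
  have n0: "n > 0" using assms(1) by simp
  obtain f where f: "bij_betw f {0..<n} {0..<n}" and E: "\<And>x y. x < n \<Longrightarrow> y < n \<Longrightarrow>
      (x, y) \<in> cay n (conn n a (a - 1) 1) \<longleftrightarrow> (f x, f y) \<in> cay n (conn n b (b - 1) 1)"
    using iso by (auto simp: graph_iso_def)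
  have fl: "f x < n" if "x < n" for x using f that by (auto simp: bij_betw_def)
  \<comment> \<open>The vertex map is extended periodically to all integers, so that the affine
    argument runs without wrap-around.\<close>
  define F where "F x = int (f (res n x))" for x
  have rl: "res n x < n" for x by (rule res_less[OF n0])
  show ?thesis
  proof (rule hexagon_graph_rigid[OF assms(1,4,5)])
    fix x y
    have "[F x = F y] (mod int n) \<longleftrightarrow> f (res n x) = f (res n y)"
      unfolding F_def using fl rl by (metis res_eq_iff n0 res_of_nat)
    also have "\<dots> \<longleftrightarrow> res n x = res n y"
      using f rl by (auto simp: bij_betw_def inj_on_def)
    finally show "[F x = F y] (mod int n) \<longleftrightarrow> [x = y] (mod int n)" using res_eq_iff[OF n0] by simp
    have d: "[int (res n x) - int (res n y) = x - y] (mod int n)"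
      by (intro cong_diff res_cong n0)
    show "hexadj n (int b) (F x - F y) \<longleftrightarrow> hexadj n (int a) (x - y)"
      using E[OF rl rl, of x y] hexadj_cong[OF d, of "int a"]
      unfolding conn_hexagon[OF n0 assms(2)] conn_hexagon[OF n0 assms(3)] 
        cay_res_iff[OF n0 rl rl] cay_res_iff[OF n0 fl[OF rl] fl[OF rl]] F_def hexadj_def by simp
  next
    fix z
    have "res n z \<in> f ` {0..<n}" using f rl by (auto simp: bij_betw_def)
    then obtain x where x: "x < n" "f x = res n z" by auto
    then have "[F (int x) = z] (mod int n)"
      using res_cong[OF n0] by (simp add: F_def res_of_nat)
    then show "\<exists>x. [F x = z] (mod int n)" by blast
  qed
qed

section \<open>Counting the roots\<close>

text \<open>This subtraction-free form suits the Chinese remainder argument over the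
  naturals.\<close>

lemma hexroot_of_nat_iff: "hexroot n (int z) \<longleftrightarrow> [z^2 + 1 = z] (mod n)"
proof -
  have "int z ^ 2 - int z + 1 - 0 = int (z^2 + 1) - int z" by simp
  then show ?thesis unfolding cong_int_iff[symmetric] cong_iff_dvd_diff by (simp only:)
qed

text \<open>The product (y - x) (y - (1 - x)) is a difference of two polynomial values, so p^k
  divides it. If p divided both factors it would divide 1 - 2x and then 3, by the discriminant
  identity 4 (x^2 - x + 1) = (1 - 2x)^2 + 3. So p^k divides one factor.\<close>

lemma hexroot_prime_power:
  assumes "prime p" "p \<noteq> 3" "hexroot (p^k) x" "hexroot (p^k) y"
  shows "[y = x] (mod int (p^k)) \<or> [y = 1 - x] (mod int (p^k))"
proof (cases "k = 0")
  case False
  have q: "int (p^k) dvd x^2 - x + 1" "int (p^k) dvd y^2 - y + 1"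
    using assms(3,4) by (simp_all only: cong_0_iff)
  have "(y - x) * (y - (1 - x)) = (y^2 - y + 1) - (x^2 - x + 1)"
    by (simp add: algebra_simps power2_eq_square)
  then have d: "int (p^k) dvd (y - x) * (y - (1 - x))" using q by (simp only: dvd_diff)
  have "\<not> (int p dvd y - x \<and> int p dvd y - (1 - x))"
  proof
    assume "int p dvd y - x \<and> int p dvd y - (1 - x)"
    then have "int p dvd (y - x) - (y - (1 - x))" using dvd_diff by blast
    then have "int p dvd 1 - 2 * x" by simp
    then have "int p dvd (1 - 2 * x) * (1 - 2 * x)" by (rule dvd_mult2)
    moreover have "int p dvd int (p^k)" using False by simp
    then have "int p dvd 4 * (x^2 - x + 1)" using q(1) by (meson dvd_mult dvd_trans)
    moreover have "4 * (x^2 - x + 1) = (1 - 2 * x) * (1 - 2 * x) + 3"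
      by (simp add: algebra_simps power2_eq_square)
    ultimately have "int p dvd 3" by (metis dvd_add_right_iff)
    then have "p dvd 3" using int_dvd_int_iff[of p 3] by simp
    then show False using assms(1,2) primes_dvd_imp_eq[of p 3] by simp
  qed
  then have "coprime (int p) (y - x) \<or> coprime (int p) (y - (1 - x))"
    using assms(1) prime_imp_coprime[of "int p"] by auto
  then have "coprime (int (p^k)) (y - x) \<or> coprime (int (p^k)) (y - (1 - x))"
    by auto
  then show ?thesis
    using d by (auto simp only: cong_iff_dvd_diff coprime_dvd_mult_left_iff coprime_dvd_mult_right_iff)
qed simp

text \<open>The discriminant is -3, so away from p = 3 the two conjugate roots stay
  distinct.\<close>

lemma prime_power_not_conj:
  assumes "prime p" "p \<noteq> 3" "k > 0" "hexroot (p^k) x"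
  shows "\<not> [x = 1 - x] (mod int (p^k))"
proof
  have pk: "int p dvd int (p^k)" using assms(3) by simp
  assume "[x = 1 - x] (mod int (p^k))"
  then have "int p dvd x - (1 - x)" using pk dvd_trans unfolding cong_iff_dvd_diff by blast
  then have "int p dvd (x - (1 - x)) * (x - (1 - x))" by (rule dvd_mult2)
  moreover have "int (p^k) dvd x^2 - x + 1" using assms(4) by (simp only: cong_0_iff)
  then have "int p dvd 4 * (x^2 - x + 1)" using pk by (meson dvd_mult dvd_trans)
  moreover have "4 * (x^2 - x + 1) = (x - (1 - x)) * (x - (1 - x)) + 3"
    by (simp add: algebra_simps power2_eq_square)
  ultimately have "int p dvd 3" by (metis dvd_add_right_iff)
  then have "p dvd 3" using int_dvd_int_iff[of p 3] by simp
  then show False using assms(1,2) primes_dvd_imp_eq[of p 3] by simp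
qed

definition hexroots :: "nat \<Rightarrow> nat set" where
  "hexroots n = {a. 1 \<le> a \<and> a < n \<and> hexroot n (int a)}"

lemma hexroots_conj:
  assumes "n > 1" "a \<in> hexroots n"
  shows "n + 1 - a \<in> hexroots n" "[int (n + 1 - a) = 1 - int a] (mod int n)"
proof -
  have a: "1 \<le> a" "a < n" "hexroot n (int a)" using assms by (auto simp: hexroots_def)
  \<comment> \<open>This keeps the representative n + 1 - a of 1 - a strictly below n.\<close>
  have "a \<noteq> 1" using a(3) assms(1) by (auto simp: cong_0_iff)
  have "int (n + 1 - a) = int n + (1 - int a)" using a by simp
  then show c: "[int (n + 1 - a) = 1 - int a] (mod int n)" by (simp add: cong_def)
  then have "hexroot n (int (n + 1 - a))"
    using hexroot_conj[OF a(3)] hexroot_cong by blast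
  moreover have "1 \<le> n + 1 - a" "n + 1 - a < n" using a \<open>a \<noteq> 1\<close> by linarith+
  ultimately show "n + 1 - a \<in> hexroots n" unfolding hexroots_def by blast
qed

lemma card_hexroots:
  assumes "n > 1" "x \<in> hexroots n" "\<not> 3 dvd n"
  shows "card (hexroots n) = 2 ^ card (prime_factors n)"
proof -
  define P where "P = prime_factors n"
  define q where "q p = p ^ multiplicity p n" for p
  define x' where "x' = n + 1 - x"
  have x: "hexroot n (int x)" using assms by (simp add: hexroots_def)
  have x': "[int x' = 1 - int x] (mod int n)" unfolding x'_def by (rule hexroots_conj[OF assms(1,2)])
  have finP: "finite P" by (simp add: P_def)
  have pr: "prime p" "p \<noteq> 3" "multiplicity p n > 0" if "p \<in> P" for p
  proof -
    show "prime p" "multiplicity p n > 0"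
      using that unfolding P_def prime_factors_multiplicity by simp_all
    have "p dvd n" using that by (simp add: P_def in_prime_factors_iff)
    then show "p \<noteq> 3" using assms(3) by blast
  qed
  have prod: "(\<Prod>p\<in>P. q p) = n"
    unfolding P_def q_def using prime_factorization_nat[of n] assms(1) by simp
  have cop: "coprime (q p) (q p')" if "p \<in> P" "p' \<in> P" "p \<noteq> p'" for p p'
    unfolding q_def using that pr by (simp add: primes_coprime)
  have nz: "q p \<noteq> 0" if "p \<in> P" for p using pr(1)[OF that] by (auto simp: q_def)
  have qn: "int (q p) dvd int n" for p
    unfolding q_def int_dvd_int_iff by (rule multiplicity_dvd)
  \<comment> \<open>A set \<open>T\<close> of prime factors prescribes where the root agrees with
    \<open>x\<close>; elsewhere it agrees with the conjugate. The Chinese remainder theorem glues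
    these choices into one root, and every root arises in this way from a unique
    \<open>T\<close>.\<close>
  define u where "u T p = (if p \<in> T then x else x')" for T :: "nat set" and p
  have ex1: "\<exists>!y. y < n \<and> (\<forall>p\<in>P. [y = u T p] (mod q p))" for T
    using chinese_remainder_unique_nat[OF finP, of q "u T"] cop nz prod by simp
  define g where "g T = (THE y. y < n \<and> (\<forall>p\<in>P. [y = u T p] (mod q p)))" for T
  have g: "g T < n" "\<And>p. p \<in> P \<Longrightarrow> [g T = u T p] (mod q p)" for T
    using theI'[OF ex1[of T]] by (auto simp: g_def)
  have root_q: "hexroot (q p) z" if "hexroot n z" for z p
    using that qn cong_dvd_modulus by blast
  have uroot: "hexroot n (int (u T p))" for T p
    using x hexroots_conj[OF assms(1,2)] by (simp add: u_def x'_def hexroots_def)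
  have notconj: "\<not> [x = x'] (mod q p)" if "p \<in> P" for p
  proof
    assume "[x = x'] (mod q p)"
    then have "[int x = int x'] (mod int (q p))" by (simp add: cong_int_iff)
    then have "[int x = 1 - int x] (mod int (q p))"
      using x' qn cong_dvd_modulus cong_trans by blast
    then show False
      using prime_power_not_conj[of p "multiplicity p n" "int x"] pr[OF that] root_q[OF x, of p]
      unfolding q_def by blast
  qed
  have inR: "g T \<in> hexroots n" for T
  proof -
    have "[(g T)^2 + 1 = g T] (mod q p)" if "p \<in> P" for p
    proof -
      have "[int (g T) = int (u T p)] (mod int (q p))" using g(2)[OF that] by (simp add: cong_int_iff)
      then have "hexroot (q p) (int (g T))" using root_q[OF uroot] hexroot_cong by blast
      then show ?thesis by (simp only: hexroot_of_nat_iff)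
    qed
    then have "[(g T)^2 + 1 = g T] (mod (\<Prod>p\<in>P. q p))"
      using cop by (intro coprime_cong_prod_nat) auto
    then have r: "hexroot n (int (g T))" by (simp only: prod hexroot_of_nat_iff)
    then have "g T \<noteq> 0" using hexroot_0[OF assms(1) r] by (metis cong_refl of_nat_0)
    then show ?thesis using r g(1) by (simp add: hexroots_def)
  qed
  have "bij_betw g (Pow P) (hexroots n)"
  proof (rule bij_betw_imageI)
    show "inj_on g (Pow P)"
    proof
      fix T T' assume T: "T \<in> Pow P" "T' \<in> Pow P" "g T = g T'"
      have "p \<in> T \<longleftrightarrow> p \<in> T'" if p: "p \<in> P" for p
      proof -
        have "[u T p = u T' p] (mod q p)"
          using g(2)[OF p, of T] g(2)[OF p, of T'] T(3) cong_sym cong_trans by metis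
        then show ?thesis
          using notconj[OF p] by (auto simp: u_def cong_sym_eq split: if_splits)
      qed
      then show "T = T'" using T by blast
    qed
    show "g ` Pow P = hexroots n"
    proof
      show "g ` Pow P \<subseteq> hexroots n" using inR by blast
      show "hexroots n \<subseteq> g ` Pow P"
      proof
        fix y assume y: "y \<in> hexroots n"
        then have yroot: "hexroot n (int y)" by (simp add: hexroots_def)
        define T where "T = {p\<in>P. [y = x] (mod q p)}"
        have "[y = u T p] (mod q p)" if p: "p \<in> P" for p
        proof (cases "p \<in> T")
          case True
          then show ?thesis by (simp add: u_def T_def)
        next
          case False
          then have "\<not> [int y = int x] (mod int (q p))" using p by (simp add: T_def cong_int_iff)
          moreover have "[int y = int x] (mod int (q p)) \<or> [int y = 1 - int x] (mod int (q p))"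
            using hexroot_prime_power[OF pr(1,2)[OF p]] root_q[OF x, of p] root_q[OF yroot, of p]
            unfolding q_def by blast
          ultimately have "[int y = 1 - int x] (mod int (q p))" by blast
          moreover have "[1 - int x = int x'] (mod int (q p))"
            using x' qn cong_dvd_modulus cong_sym by blast
          ultimately have "[int y = int x'] (mod int (q p))" using cong_trans by blast
          then show ?thesis using False by (simp add: u_def cong_int_iff)
        qed
        then have "y = g T"
          using ex1[of T] g(1)[of T] g(2)[of _ T] y unfolding hexroots_def by blast
        moreover have "T \<in> Pow P" by (auto simp: T_def)
        ultimately show "y \<in> g ` Pow P" by blast
      qed
    qed
  qed
  then have "card (hexroots n) = card (Pow P)" using bij_betw_same_card by metis
  then show ?thesis using finP by (simp add: card_Pow P_def)
qed

lemma card_image_two_to_one: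
  assumes "finite A" "\<And>a. a \<in> A \<Longrightarrow> card {b \<in> A. f b = f a} = 2"
  shows "card A = 2 * card (f ` A)"
proof -
  have "card A = (\<Sum>y\<in>f ` A. card {b \<in> A. f b = y})"
    using sum.image_gen[OF assms(1), of "\<lambda>_. 1::nat" f] by simp
  also have "\<dots> = (\<Sum>y\<in>f ` A. 2)" using assms(2) by (intro sum.cong) auto
  finally show ?thesis by simp
qed

lemma card_quotient_identity: "card (A // {(x, y). x \<in> A \<and> y \<in> A \<and> x = y}) = card A"
proof -
  have "A // {(x, y). x \<in> A \<and> y \<in> A \<and> x = y} = (\<lambda>x. {x}) ` A"
    by (auto simp: quotient_def)
  then show ?thesis by (simp add: card_image)
qed

section \<open>The classification\<close>

lemma hexroots_conn_conj:
  assumes "n > 1" "a \<in> hexroots n"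
  shows "conn n (n + 1 - a) (n + 1 - a - 1) 1 = conn n a (a - 1) 1"
proof -
  have "1 \<le> n + 1 - a" "1 \<le> a" "n > 0"
    using hexroots_conj(1)[OF assms] assms by (auto simp: hexroots_def)
  then show ?thesis
    using res_hexagon_cong[OF _ hexroots_conj(2)[OF assms]] by (simp only: conn_hexagon hexagon_conj)
qed

lemma hexroots_graph_iso:
  assumes "n \<ge> 7" "a \<in> hexroots n" "b \<in> hexroots n"
    and iso: "graph_iso n (cay n (conn n a (a - 1) 1)) (cay n (conn n b (b - 1) 1))"
  shows "b = a \<or> b = n + 1 - a"
proof (cases "n = 7")
  case True
  \<comment> \<open>For n = 7 rigidity fails, but the only roots are 3 and 5, and these are
    conjugate.\<close>
  have "x = 3 \<or> x = 5" if "x \<in> hexroots 7" for x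
  proof -
    have "x \<in> {1,2,3,4,5,6}" "hexroot 7 (int x)" using that by (auto simp: hexroots_def)
    then show ?thesis by (elim insertE emptyE) (simp_all add: cong_def)
  qed
  then have "(a = 3 \<or> a = 5) \<and> (b = 3 \<or> b = 5)" using assms(2,3) True by blast
  then show ?thesis using True by auto
next
  case False
  then have n: "n > 7" using assms(1) by simp
  have ab: "1 \<le> a" "a < n" "hexroot n (int a)" "1 \<le> b" "b < n" "hexroot n (int b)"
    using assms(2,3) by (auto simp: hexroots_def)
  have b': "n + 1 - b < n" "[int (n + 1 - b) = 1 - int b] (mod int n)"
    using hexroots_conj[OF _ assms(3)] n by (auto simp: hexroots_def)
  have "[int a = int b] (mod int n) \<or> [int a = int (n + 1 - b)] (mod int n)"
    using graph_iso_hexroot[OF n ab(1,4,3,6) iso] b'(2) cong_sym cong_trans by blast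
  then have "a = b \<or> a = n + 1 - b"
    using ab b'(1) by (metis cong_int_iff cong_less_modulus_unique_nat)
  then show ?thesis using ab by auto
qed

lemma graph_iso_refl: "graph_iso n E E"
  unfolding graph_iso_def by (intro exI[of _ id]) auto

lemma frob_circs_eq:
  assumes "n \<ge> 7" "coprime n 6"
  shows "frob_circs n = (\<lambda>a. cay n (conn n a (a - 1) 1)) ` hexroots n"
proof
  show "frob_circs n \<subseteq> (\<lambda>a. cay n (conn n a (a - 1) 1)) ` hexroots n"
  proof
    fix E assume "E \<in> frob_circs n"
    then obtain a b H where "E = cay n (conn n a b 1)" "frob_circ n a b H"
      by (auto simp: frob_circs_def)
    then show "E \<in> (\<lambda>a. cay n (conn n a (a - 1) 1)) ` hexroots n"
      by (auto elim!: frob_circ_hexroot[OF assms(1)] simp: hexroots_def)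
  qed
  show "(\<lambda>a. cay n (conn n a (a - 1) 1)) ` hexroots n \<subseteq> frob_circs n"
    using hexagon_circulant(3)[OF assms] unfolding hexroots_def frob_circs_def by blast
qed

text \<open>Isomorphic graphs come from equal or conjugate roots, and conjugate roots give the same
  connection set.\<close>

lemma frob_circs_graph_iso_iff:
  assumes "n \<ge> 7" "coprime n 6" "E \<in> frob_circs n" "E' \<in> frob_circs n"
  shows "graph_iso n E E' \<longleftrightarrow> E = E'"
proof
  assume iso: "graph_iso n E E'"
  obtain a b where ab: "a \<in> hexroots n" "b \<in> hexroots n"
    "E = cay n (conn n a (a - 1) 1)" "E' = cay n (conn n b (b - 1) 1)"
    using assms by (auto simp: frob_circs_eq)
  then have "b = a \<or> b = n + 1 - a" using hexroots_graph_iso assms(1) iso by blast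
  then show "E = E'" using hexroots_conn_conj[of n a] ab assms(1) by auto
qed (simp add: graph_iso_refl)

lemma card_frob_circs:
  assumes "n \<ge> 7" "coprime n 6" "hexroots n \<noteq> {}"
  shows "card (frob_circs n) = 2 ^ (card (prime_factors n) - 1)"
proof -
  let ?f = "\<lambda>a. cay n (conn n a (a - 1) 1)"
  have n1: "n > 1" using assms(1) by simp
  have fin: "finite (hexroots n)" by (rule finite_subset[of _ "{..<n}"]) (auto simp: hexroots_def)
  have "card {b \<in> hexroots n. ?f b = ?f a} = 2" if a: "a \<in> hexroots n" for a
  proof -
    have "{b \<in> hexroots n. ?f b = ?f a} = {a, n + 1 - a}"
    proof
      show "{b \<in> hexroots n. ?f b = ?f a} \<subseteq> {a, n + 1 - a}"
        using hexroots_graph_iso[OF assms(1) a] graph_iso_refl by fastforce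
      show "{a, n + 1 - a} \<subseteq> {b \<in> hexroots n. ?f b = ?f a}"
        using a hexroots_conn_conj[OF n1 a] hexroots_conj(1)[OF n1 a] by auto
    qed
    moreover have "tl_valid n a (a - 1) 1"
      using a hexroot_tl_valid[OF assms(1)] by (auto simp: hexroots_def)
    then have "a \<noteq> n - (a - 1)" "1 \<le> a" "a \<le> n - 1" by (auto simp: tl_valid_def)
    \<comment> \<open>A root is never its own conjugate, so every fibre has exactly two
      elements.\<close>
    then have "a \<noteq> n + 1 - a" by linarith
    ultimately show ?thesis by simp
  qed
  then have "card (hexroots n) = 2 * card (?f ` hexroots n)"
    by (rule card_image_two_to_one[OF fin])
  moreover have "\<not> 3 dvd n"
    using assms(2) coprime_common_divisor[of n 6 3] by auto
  then have "card (hexroots n) = 2 ^ card (prime_factors n)"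
    using card_hexroots[OF n1] assms(3) by blast
  moreover obtain p where "prime p" "p dvd n" using n1 prime_factor_nat[of n] by auto
  then have "p \<in> prime_factors n" using n1 by (simp add: in_prime_factors_iff)
  then have "card (prime_factors n) > 0" by (metis card_gt_0_iff empty_iff finite_set_mset)
  \<comment> \<open>With at least one prime factor the exponent l - 1 is a true difference, so
    halving 2^l gives 2^(l-1).\<close>
  then obtain k where "card (prime_factors n) = Suc k" using gr0_implies_Suc by blast
  ultimately show ?thesis by (simp add: frob_circs_eq[OF assms(1,2)])
qed

lemma mod_6_eq_1_imp_coprime: "(n::nat) mod 6 = 1 \<Longrightarrow> coprime n 6"
  by (metis coprime_1_left coprime_mod_left_iff zero_neq_numeral)

lemma frob_circ_iff:
  assumes "n \<ge> 7"
  shows "(\<exists>a b H. frob_circ n a b H) \<longleftrightarrow> n mod 6 = 1 \<and> (\<exists>x. hexroot n x)"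
proof
  assume "\<exists>a b H. frob_circ n a b H"
  then obtain x where x: "hexroot n (int x)" "coprime (int x + 1) (int n)"
    using frob_circ_hexroot[OF assms] by blast
  then have "n mod 6 = 1"
    using mod6_from_primes[of n] hexroot_prime_factor[OF x] assms by simp
  then show "n mod 6 = 1 \<and> (\<exists>x. hexroot n x)" using x by blast
next
  assume A: "n mod 6 = 1 \<and> (\<exists>x. hexroot n x)"
  then obtain x where x: "hexroot n x" by blast
  have n: "n > 0" "n > 1" using assms by simp_all
  have r: "hexroot n (int (res n x))" using x hexroot_cong res_cong[OF n(1)] by blast
  have "res n x \<noteq> 0" using hexroot_0[OF n(2) r] by (metis cong_refl of_nat_0)
  then have "1 \<le> res n x" by simp
  then show "\<exists>a b H. frob_circ n a b H"
    using hexagon_circulant(3)[OF assms _ _ res_less[OF n(1)] r] mod_6_eq_1_imp_coprime A by blast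
qed

theorem theorem2p2:
  fixes n :: nat
  assumes "n \<ge> 7"
  shows "((\<exists>a b H. frob_circ n a b H) \<longleftrightarrow>
           (n mod 6 = 1 \<and> (\<exists>x::int. [x^2 - x + 1 = 0] (mod int n))))
       \<and> ((\<exists>a b H. frob_circ n a b H) \<longrightarrow>
           (\<forall>p. prime p \<and> p dvd n \<longrightarrow> p mod 6 = 1)
         \<and> (\<forall>a. 1 \<le> a \<and> a < n \<and> [int a ^ 2 - int a + 1 = 0] (mod int n) \<longrightarrow>
               (let H = cyc n a; S = conn n a (a - 1) 1 in
                  frob_circ n a (a - 1) H
                \<and> rotational n S \<and> geometric n a (a - 1) 1
                \<and> arc_transitive n H (cay n S) \<and> first_kind n H S
                \<and> complete_rotation n S a \<and> complete_rotation n S (negm n (a ^ 2))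
                \<and> H = {1, n - 1, a, n - a, (a ^ 2) mod n, negm n (a ^ 2)}
                \<and> H = {1, n - 1, a, n - a, a - 1, n - (a - 1)}
                \<and> (\<forall>b H'. frob_circ n a b H' \<longrightarrow> b mod n = (a - 1) mod n \<or> b mod n = negm n (a - 1))))
         \<and> (\<forall>a b H. frob_circ n a b H \<longrightarrow>
               (\<exists>x. 1 \<le> x \<and> x < n \<and> [int x ^ 2 - int x + 1 = 0] (mod int n) \<and>
                    conn n a b 1 = conn n x (x - 1) 1))
         \<and> card (frob_circs n // {(E1, E2). E1 \<in> frob_circs n \<and> E2 \<in> frob_circs n \<and> graph_iso n E1 E2})
             = 2 ^ (card (prime_factors n) - 1)
         \<and> (\<forall>E\<in>frob_circs n. \<exists>a. 1 \<le> a \<and> a < n \<and> [int a ^ 2 - int a + 1 = 0] (mod int n) \<and>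
               graph_iso n E (cay n (conn n a (a - 1) 1))))"
proof (intro conjI impI)
  show "(\<exists>a b H. frob_circ n a b H) \<longleftrightarrow> (n mod 6 = 1 \<and> (\<exists>x::int. [x^2 - x + 1 = 0] (mod int n)))"
    by (rule frob_circ_iff[OF assms])
next
  assume ex: "\<exists>a b H. frob_circ n a b H"
  then have cop: "coprime n 6"
    using frob_circ_iff[OF assms] mod_6_eq_1_imp_coprime by blast
  obtain x where x: "1 \<le> x" "x < n" "hexroot n (int x)" "coprime (int x + 1) (int n)"
    using ex frob_circ_hexroot[OF assms] by blast
  show "\<forall>p. prime p \<and> p dvd n \<longrightarrow> p mod 6 = 1"
    using hexroot_prime_factor[OF x(3,4)] by blast
  show "\<forall>a. 1 \<le> a \<and> a < n \<and> [int a ^ 2 - int a + 1 = 0] (mod int n) \<longrightarrow>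
               (let H = cyc n a; S = conn n a (a - 1) 1 in
                  frob_circ n a (a - 1) H
                \<and> rotational n S \<and> geometric n a (a - 1) 1
                \<and> arc_transitive n H (cay n S) \<and> first_kind n H S
                \<and> complete_rotation n S a \<and> complete_rotation n S (negm n (a ^ 2))
                \<and> H = {1, n - 1, a, n - a, (a ^ 2) mod n, negm n (a ^ 2)}
                \<and> H = {1, n - 1, a, n - a, a - 1, n - (a - 1)}
                \<and> (\<forall>b H'. frob_circ n a b H' \<longrightarrow> b mod n = (a - 1) mod n \<or> b mod n = negm n (a - 1)))"
  proof (intro allI impI)
    fix a assume "1 \<le> a \<and> a < n \<and> hexroot n (int a)"
    then have a: "1 \<le> a" "a < n" "hexroot n (int a)" by auto
    note h = hexagon_circulant[OF assms cop a]
    have fk: "first_kind n (cyc n a) (conn n a (a - 1) 1)"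
      using h(3) by (simp only: frob_circ_def)
    have b: "b mod n = (a - 1) mod n \<or> b mod n = negm n (a - 1)" if "frob_circ n a b H'" for b H'
      using frob_circ_hexroot[OF assms that] a(3) by metis
    show "let H = cyc n a; S = conn n a (a - 1) 1 in
                  frob_circ n a (a - 1) H
                \<and> rotational n S \<and> geometric n a (a - 1) 1
                \<and> arc_transitive n H (cay n S) \<and> first_kind n H S
                \<and> complete_rotation n S a \<and> complete_rotation n S (negm n (a ^ 2))
                \<and> H = {1, n - 1, a, n - a, (a ^ 2) mod n, negm n (a ^ 2)}
                \<and> H = {1, n - 1, a, n - a, a - 1, n - (a - 1)}
                \<and> (\<forall>b H'. frob_circ n a b H' \<longrightarrow> b mod n = (a - 1) mod n \<or> b mod n = negm n (a - 1))"
      unfolding Let_def by (intro conjI allI impI h(3-10) fk b)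
  qed
  show "\<forall>a b H. frob_circ n a b H \<longrightarrow>
               (\<exists>x. 1 \<le> x \<and> x < n \<and> [int x ^ 2 - int x + 1 = 0] (mod int n) \<and>
                    conn n a b 1 = conn n x (x - 1) 1)"
    using frob_circ_hexroot[OF assms] by metis
  \<comment> \<open>On these graphs isomorphism is equality, so all classes are singletons and
    counting classes is counting graphs.\<close>
  have "{(E1, E2). E1 \<in> frob_circs n \<and> E2 \<in> frob_circs n \<and> graph_iso n E1 E2}
      = {(E1, E2). E1 \<in> frob_circs n \<and> E2 \<in> frob_circs n \<and> E1 = E2}"
    using frob_circs_graph_iso_iff[OF assms cop] by auto
  moreover have "hexroots n \<noteq> {}" using x by (auto simp: hexroots_def)
  then have "card (frob_circs n) = 2 ^ (card (prime_factors n) - 1)"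
    by (rule card_frob_circs[OF assms cop])
  ultimately show "card (frob_circs n // {(E1, E2). E1 \<in> frob_circs n \<and> E2 \<in> frob_circs n \<and> graph_iso n E1 E2})
             = 2 ^ (card (prime_factors n) - 1)"
    by (simp only: card_quotient_identity)
  show "\<forall>E\<in>frob_circs n. \<exists>a. 1 \<le> a \<and> a < n \<and> [int a ^ 2 - int a + 1 = 0] (mod int n) \<and>
               graph_iso n E (cay n (conn n a (a - 1) 1))"
    using graph_iso_refl unfolding frob_circs_eq[OF assms cop] hexroots_def by blast
qed

end
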